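(* Let $\bm y(t)$ be the continuous solution of $\bm y'(t)=\bm f(\bm y(t))$, $\bm y(0)=\bm y_0\in\mathbb{R}^N_+$, for $t\in[0,T]$, under the assumption that $\mathbb{R}^N_+$ is forward invariant under the flow. For a given $N_t\in\mathbb{N}$, let $\{\bm y^n\}_{n=0}^{N_t}$ denote the numerical approximation obtained by the SPIDeC scheme with $M+1$ stages, $N_k$ correction sweeps and uniform stepsize $h=T/N_t$. Assume that $\bm f\in C^q(\Omega)$, where $q=\max\{M+1,N_k+1\}$ and $\Omega\subset\mathbb{R}^N_+$ is a compact set satisfying $$\{\bm\omega=[\omega_1,\dots,\omega_N]^\top:\ 0<\alpha\le\omega_i\le\beta,\ i=1,\dots,N\}\subset\mathring{\Omega},\qquad \alpha=\min_{1\le i\le N,\,0\le t\le T}|y_i(t)|,\quad \beta=\max_{i=1,\dots,N}\|y_i\|_{L^\infty([0,T])},$$ with $\mathring\Omega$ the interior of $\Omega$. Then the global approximation error satisfies $$\max_{0\le n\le N_t}\|\bm y(t_n)-\bm y^n\|=\mathcal{O}(h^p)\quad (h\to0),\qquad p=\min\{M+1,N_k+1\}.$$ Consequently, the SPIDeC method is convergent of order $p$.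
   Context: $\mathbb{R}^N_+=\{\bm\eta\in\mathbb{R}^N:\eta_i>0\ \forall i\}$; $\bm f=[f_1,\dots,f_N]^\top$ is a sufficiently smooth $\mathbb{R}^N$-valued function defined on an open set containing $\mathbb{R}^N_+$. Forward invariance means that solutions starting in $\mathbb{R}^N_+$ remain in $\mathbb{R}^N_+$ for all $t\in[0,T]$. Let $M,N_k\ge0$ be integers, $t_n=nh$, $n=0,\dots,N_t$. Let $0\le\tau_0<\tau_1<\dots<\tau_M=1$ be fixed quadrature nodes with Lagrange basis polynomials $\ell_0,\dots,\ell_M$ (of degree at most $M$), and $Q_{m,j}=\int_0^{\tau_m}\ell_j(\tau)\,d\tau$ for $m,j=0,\dots,M$. The SPIDeC scheme with $M+1$ stages and $N_k$ correction sweeps is, for $i=1,\dots,N$, $m=0,\dots,M$, starting from $\bm y^0=\bm y(0)$: $$y^{n,m}_{i(0)}=y_i^n\exp\Big(h\tau_m\frac{f_i(\bm y^n)}{y_i^n}\Big),\qquad y^{n,m}_{i(k)}=y_i^n\exp\Big(h\sum_{j=0}^M Q_{m,j}\frac{f_i(\bm y^{n,j}_{(k-1)})}{y^{n,j}_{i(k-1)}}\Big),\quad k=1,\dots,N_k,\qquad y_i^{n+1}=y^{n,M}_{i(N_k)}.$$ *)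

theory Defs
  imports
    "HOL-Analysis.Analysis"
    "HOL-Probability.Essential_Supremum"
    "HOL-Library.Landau_Symbols"
begin

section \<open>Initial value problems in the positive orthant\<close>

definition pos_orthant :: "(real ^ 'n) set" where
  "pos_orthant = {\<eta>. \<forall>i. 0 < \<eta> $ i}"

text \<open>The vector field is defined on \<open>D\<close> only, so a solution is required to take values in \<open>D\<close>.\<close>

definition solves_ode_on ::
    "(real ^ 'n) set \<Rightarrow> (real ^ 'n \<Rightarrow> real ^ 'n) \<Rightarrow> real \<Rightarrow> (real \<Rightarrow> real ^ 'n) \<Rightarrow> bool" where
  "solves_ode_on D f T y \<longleftrightarrow>
     (\<forall>t\<in>{0..T}. y t \<in> D \<and> (y has_vector_derivative f (y t)) (at t within {0..T}))"

definition forward_invariant ::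
    "(real ^ 'n) set \<Rightarrow> (real ^ 'n \<Rightarrow> real ^ 'n) \<Rightarrow> real \<Rightarrow> (real ^ 'n) set \<Rightarrow> bool" where
  "forward_invariant D f T S \<longleftrightarrow>
     (\<forall>y. solves_ode_on D f T y \<and> y 0 \<in> S \<longrightarrow> (\<forall>t\<in>{0..T}. y t \<in> S))"

text \<open>
  \<open>C_k_on k K f\<close>: \<open>f\<close> is of class \<open>C\<^sup>k\<close> in the interior of \<open>K\<close>, and \<open>f\<close> and its
  derivatives up to order \<open>k\<close> extend continuously to \<open>K\<close>. The function \<open>g\<close> below is such an
  extension of the derivative of \<open>f\<close> in direction \<open>v\<close>. For open \<open>K\<close> this is the usual class
  \<open>C\<^sup>k\<close>; a function of class \<open>C\<^sup>k\<close> on an open superset of \<open>K\<close> satisfies it as well.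
\<close>

fun C_k_on :: "nat \<Rightarrow> 'a::euclidean_space set \<Rightarrow> ('a \<Rightarrow> 'b::real_normed_vector) \<Rightarrow> bool" where
  "C_k_on 0 K f \<longleftrightarrow> continuous_on K f"
| "C_k_on (Suc k) K f \<longleftrightarrow>
     continuous_on K f \<and> (\<forall>x\<in>interior K. f differentiable (at x)) \<and>
     (\<forall>v. \<exists>g. (\<forall>x\<in>interior K. g x = frechet_derivative f (at x) v) \<and> C_k_on k K g)"

definition Linf_norm :: "real set \<Rightarrow> (real \<Rightarrow> real) \<Rightarrow> real" where
  "Linf_norm S g = real_of_ereal (esssup (lebesgue_on S) (\<lambda>t. ereal \<bar>g t\<bar>))"

text \<open>For the continuous functions considered here the infimum below is attained.\<close>

definition min_component :: "real \<Rightarrow> (real \<Rightarrow> real ^ 'n) \<Rightarrow> real" where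
  "min_component T y = (INF (i, t)\<in>UNIV \<times> {0..T}. \<bar>y t $ i\<bar>)"

definition max_component :: "real \<Rightarrow> (real \<Rightarrow> real ^ 'n) \<Rightarrow> real" where
  "max_component T y = (MAX i. Linf_norm {0..T} (\<lambda>t. y t $ i))"

definition admissible_ivp ::
    "nat \<Rightarrow> (real ^ 'n) set \<Rightarrow> (real ^ 'n) set \<Rightarrow> real \<Rightarrow> (real ^ 'n \<Rightarrow> real ^ 'n) \<Rightarrow>
     real ^ 'n \<Rightarrow> (real \<Rightarrow> real ^ 'n) \<Rightarrow> bool" where
  "admissible_ivp q D \<Omega> T f y\<^sub>0 y \<longleftrightarrow>
     open D \<and> pos_orthant \<subseteq> D \<and>
     0 < T \<and>
     y\<^sub>0 \<in> pos_orthant \<and> solves_ode_on D f T y \<and> y 0 = y\<^sub>0 \<and>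
     forward_invariant D f T pos_orthant \<and>
     compact \<Omega> \<and> \<Omega> \<subseteq> pos_orthant \<and> C_k_on q \<Omega> f \<and>
     (let \<alpha> = min_component T y; \<beta> = max_component T y
      in {\<omega>. \<forall>i. 0 < \<alpha> \<and> \<alpha> \<le> \<omega> $ i \<and> \<omega> $ i \<le> \<beta>} \<subseteq> interior \<Omega>)"

section \<open>The SPIDeC scheme\<close>

definition lagrange_basis :: "nat \<Rightarrow> (nat \<Rightarrow> real) \<Rightarrow> nat \<Rightarrow> real \<Rightarrow> real" where
  "lagrange_basis M \<tau> j x = (\<Prod>i\<in>{..M} - {j}. (x - \<tau> i) / (\<tau> j - \<tau> i))"

definition quad_weight :: "nat \<Rightarrow> (nat \<Rightarrow> real) \<Rightarrow> nat \<Rightarrow> nat \<Rightarrow> real" where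
  "quad_weight M \<tau> m j = integral {0..\<tau> m} (lagrange_basis M \<tau> j)"

text \<open>\<open>spidec_stage M \<tau> f h y k m\<close> is the stage value with node index \<open>m\<close> after \<open>k\<close> sweeps,
  computed from the value \<open>y\<close> at the beginning of the step.\<close>

fun spidec_stage ::
    "nat \<Rightarrow> (nat \<Rightarrow> real) \<Rightarrow> (real ^ 'n \<Rightarrow> real ^ 'n) \<Rightarrow> real \<Rightarrow> real ^ 'n \<Rightarrow> nat \<Rightarrow> nat \<Rightarrow> real ^ 'n" where
  "spidec_stage M \<tau> f h y 0 m = (\<chi> i. y $ i * exp (h * \<tau> m * (f y $ i / y $ i)))"
| "spidec_stage M \<tau> f h y (Suc k) m =
     (\<chi> i. y $ i * exp (h * (\<Sum>j\<le>M. quad_weight M \<tau> m j *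
        (f (spidec_stage M \<tau> f h y k j) $ i / spidec_stage M \<tau> f h y k j $ i))))"

fun spidec ::
    "nat \<Rightarrow> (nat \<Rightarrow> real) \<Rightarrow> nat \<Rightarrow> (real ^ 'n \<Rightarrow> real ^ 'n) \<Rightarrow> real \<Rightarrow> real ^ 'n \<Rightarrow> nat \<Rightarrow> real ^ 'n" where
  "spidec M \<tau> N\<^sub>k f h y\<^sub>0 0 = y\<^sub>0"
| "spidec M \<tau> N\<^sub>k f h y\<^sub>0 (Suc n) = spidec_stage M \<tau> f h (spidec M \<tau> N\<^sub>k f h y\<^sub>0 n) N\<^sub>k M"

section \<open>Convergence of one-step methods\<close>

text \<open>A method maps a vector field \<open>f\<close>, a stepsize \<open>h\<close> and an initial value to the sequence of
  numerical approximations; \<open>N\<^sub>t\<close> is the number of steps.\<close>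

definition global_error ::
    "((real ^ 'n \<Rightarrow> real ^ 'n) \<Rightarrow> real \<Rightarrow> real ^ 'n \<Rightarrow> nat \<Rightarrow> real ^ 'n) \<Rightarrow> real \<Rightarrow>
     (real ^ 'n \<Rightarrow> real ^ 'n) \<Rightarrow> real ^ 'n \<Rightarrow> (real \<Rightarrow> real ^ 'n) \<Rightarrow> nat \<Rightarrow> real" where
  "global_error \<Phi> T f y\<^sub>0 y N\<^sub>t =
     (let h = T / real N\<^sub>t in MAX n\<in>{0..N\<^sub>t}. norm (y (real n * h) - \<Phi> f h y\<^sub>0 n))"

text \<open>Convergence of order \<open>p\<close> on the class of initial value problems that are admissible with
  smoothness \<open>q\<close>.\<close>

definition convergent_of_order ::
    "((real ^ 'n \<Rightarrow> real ^ 'n) \<Rightarrow> real \<Rightarrow> real ^ 'n \<Rightarrow> nat \<Rightarrow> real ^ 'n) \<Rightarrow> nat \<Rightarrow> nat \<Rightarrow> bool" where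
  "convergent_of_order \<Phi> q p \<longleftrightarrow>
     (\<forall>D \<Omega> T f y\<^sub>0 y. admissible_ivp q D \<Omega> T f y\<^sub>0 y \<longrightarrow>
        (\<lambda>N\<^sub>t. global_error \<Phi> T f y\<^sub>0 y N\<^sub>t) \<in> O(\<lambda>N\<^sub>t. (T / real N\<^sub>t) ^ p))"

end

theory Submission
  imports Defs
begin

text \<open>
  SPIDeC multiplies each component by an exponential, so in the variables \<open>u\<^sub>i = ln y\<^sub>i\<close> it is an
  additive method: explicit Euler predictions followed by Picard iterations for the collocation
  equations of \<open>u' = g u\<close> with \<open>g\<^sub>i u = f\<^sub>i (exp u) / exp u\<^sub>i\<close> (\<open>spidec_vec_exp\<close>). It is therefore enough
  to prove convergence of these sweeps for \<open>u\<close> and to transport the bound through the exponential,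
  which is Lipschitz near a bounded trajectory.

  The order has two sources. First, \<open>u\<close> solves the collocation equations up to a residual of order
  \<open>h ^ (M + 2)\<close>: the curve \<open>g \<circ> u\<close> is \<open>M + 1\<close> times continuously differentiable, so its interpolation
  error at \<open>M + 1\<close> nodes is of order \<open>h ^ (M + 1)\<close> (\<open>interpolation_error\<close>, \<open>collocation_residual\<close>).
  Second, the Euler prediction is accurate to order \<open>h\<^sup>2\<close>, and every sweep multiplies the error of the
  previous stages by \<open>O(h)\<close>, because the nonlinearity enters with a factor \<open>h\<close>. After \<open>k\<close> sweeps the
  local error is of order \<open>h ^ (min k M + 2)\<close> (\<open>picard_sweep_error\<close>), and after \<open>N\<^sub>k\<close> sweeps this is
  \<open>h ^ (p + 1)\<close>. A discrete Gronwall argument sums the local errors to a global error of order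
  \<open>h ^ p\<close> (\<open>one_step_convergence\<close>).

  All estimates are local: Lipschitz bounds for \<open>f\<close> are available only near the trajectory, which lies
  in the interior of \<open>\<Omega>\<close> (\<open>admissible_ivp_trajectory\<close>). The one-step estimate is therefore restricted to
  small steps and small errors, and the Gronwall induction shows that, for small steps, the numerical
  solution never leaves the region where it holds. Smoothness of the trajectory is
  inherited from \<open>f\<close> through the differential equation (\<open>C_k_curve_ode_solution\<close>).
\<close>

section \<open>Smooth curves\<close>

text \<open>
  Each derivative is required to exist as a function on \<open>I\<close> itself, one-sided at the end points of a
  compact interval, so that closure properties follow by induction on the order without extending
  a curve beyond \<open>I\<close>.
\<close>

fun C_k_curve :: "nat \<Rightarrow> real set \<Rightarrow> (real \<Rightarrow> 'a::real_normed_vector) \<Rightarrow> bool" where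
  "C_k_curve 0 I v \<longleftrightarrow> continuous_on I v"
| "C_k_curve (Suc k) I v \<longleftrightarrow>
     (\<exists>v'. (\<forall>t\<in>I. (v has_vector_derivative v' t) (at t within I)) \<and> C_k_curve k I v')"

lemma C_k_curve_cong:
  assumes "\<And>t. t \<in> I \<Longrightarrow> v t = w t" "C_k_curve k I v"
  shows "C_k_curve k I w"
proof (cases k)
  case 0
  with assms show ?thesis by (simp cong: continuous_on_cong)
next
  case (Suc j)
  with assms obtain v' where v': "\<And>t. t \<in> I \<Longrightarrow> (v has_vector_derivative v' t) (at t within I)"
    "C_k_curve j I v'"
    by auto
  have "(w has_vector_derivative v' t) (at t within I)" if "t \<in> I" for t
    using has_vector_derivative_transform[OF that _ v'(1)[OF that], of w] assms(1) by simp
  with v'(2) Suc show ?thesis by auto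
qed

lemma C_k_curve_continuous: "C_k_curve k I v \<Longrightarrow> continuous_on I v"
proof (cases k)
  case (Suc j)
  assume "C_k_curve k I v"
  with Suc show ?thesis
    by (metis C_k_curve.simps(2) continuous_on_eq_continuous_within has_vector_derivative_continuous)
qed simp

lemma C_k_curve_SucD: "C_k_curve (Suc k) I v \<Longrightarrow> C_k_curve k I v"
proof (induction k arbitrary: v)
  case 0
  then show ?case using C_k_curve_continuous C_k_curve.simps(1) by blast
next
  case (Suc k)
  then show ?case by (metis C_k_curve.simps(2))
qed

lemma C_k_curve_mono: "C_k_curve n I v \<Longrightarrow> k \<le> n \<Longrightarrow> C_k_curve k I v"
  by (induction n) (use C_k_curve_SucD le_Suc_eq in blast)+

lemma C_k_curve_const: "C_k_curve k I (\<lambda>_. c)"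
  by (induction k arbitrary: c) (auto intro: exI[of _ "\<lambda>_. 0"])

lemma C_k_curve_add:
  "C_k_curve k I v \<Longrightarrow> C_k_curve k I w \<Longrightarrow> C_k_curve k I (\<lambda>t. v t + w t)"
proof (induction k arbitrary: v w)
  case 0
  then show ?case by (simp add: continuous_on_add)
next
  case (Suc k)
  from Suc.prems obtain v' w' where "\<forall>t\<in>I. (v has_vector_derivative v' t) (at t within I)"
    "C_k_curve k I v'" "\<forall>t\<in>I. (w has_vector_derivative w' t) (at t within I)" "C_k_curve k I w'"
    by auto
  then show ?case
    using Suc.IH by (auto intro!: exI[of _ "\<lambda>t. v' t + w' t"] has_vector_derivative_add)
qed

lemma C_k_curve_sum:
  assumes "\<And>i. i \<in> A \<Longrightarrow> C_k_curve k I (v i)"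
  shows "C_k_curve k I (\<lambda>t. \<Sum>i\<in>A. v i t)"
  using assms
  by (induction A rule: infinite_finite_induct) (auto intro: C_k_curve_const C_k_curve_add)

lemma (in bounded_linear) C_k_curve:
  "C_k_curve k I v \<Longrightarrow> C_k_curve k I (\<lambda>t. f (v t))"
proof (induction k arbitrary: v)
  case 0
  then show ?case by (simp add: continuous_on)
next
  case (Suc k)
  then obtain v' where "\<forall>t\<in>I. (v has_vector_derivative v' t) (at t within I)" "C_k_curve k I v'"
    by auto
  then show ?case
    using Suc.IH by (auto intro!: exI[of _ "\<lambda>t. f (v' t)"] has_vector_derivative)
qed

lemma (in bounded_bilinear) C_k_curve:
  "C_k_curve k I v \<Longrightarrow> C_k_curve k I w \<Longrightarrow> C_k_curve k I (\<lambda>t. prod (v t) (w t))"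
proof (induction k arbitrary: v w)
  case 0
  then show ?case by (simp add: continuous_on)
next
  case (Suc k)
  from Suc.prems obtain v' w' where "\<forall>t\<in>I. (v has_vector_derivative v' t) (at t within I)"
    "C_k_curve k I v'" "\<forall>t\<in>I. (w has_vector_derivative w' t) (at t within I)" "C_k_curve k I w'"
    by auto
  moreover have "C_k_curve k I v" "C_k_curve k I w"
    using Suc.prems C_k_curve_SucD by blast+
  ultimately show ?case
    using Suc.IH
    by (auto intro!: exI[of _ "\<lambda>t. prod (v t) (w' t) + prod (v' t) (w t)"]
        has_vector_derivative C_k_curve_add)
qed

lemma C_k_curve_inverse:
  fixes v :: "real \<Rightarrow> real"
  assumes nz: "\<And>t. t \<in> I \<Longrightarrow> v t \<noteq> 0"
  shows "C_k_curve k I v \<Longrightarrow> C_k_curve k I (\<lambda>t. inverse (v t))"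
proof (induction k)
  case 0
  then show ?case using nz by (auto intro: continuous_on_inverse)
next
  case (Suc k)
  then obtain v' where v': "\<forall>t\<in>I. (v has_vector_derivative v' t) (at t within I)" "C_k_curve k I v'"
    by auto
  have inv: "C_k_curve k I (\<lambda>t. inverse (v t))"
    using Suc C_k_curve_SucD by blast
  have "C_k_curve k I (\<lambda>t. - (inverse (v t) * v' t * inverse (v t)))"
    by (intro bounded_linear.C_k_curve[OF bounded_linear_minus[OF bounded_linear_ident]]
        bounded_bilinear.C_k_curve[OF bounded_bilinear_mult] inv v'(2))
  moreover have "((\<lambda>t. inverse (v t)) has_vector_derivative - (inverse (v t) * v' t * inverse (v t)))
      (at t within I)" if "t \<in> I" for t
    using DERIV_inverse'[of v "v' t" t I] that v'(1) nz
    by (simp add: has_real_derivative_iff_has_vector_derivative)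
  ultimately show ?case
    by (auto intro!: exI[of _ "\<lambda>t. - (inverse (v t) * v' t * inverse (v t))"])
qed

lemma C_k_curve_vec:
  fixes v :: "real \<Rightarrow> real ^ 'n"
  assumes "\<And>i. C_k_curve k I (\<lambda>t. v t $ i)"
  shows "C_k_curve k I v"
proof -
  have "C_k_curve k I (\<lambda>t. \<Sum>i\<in>UNIV. (v t $ i) *\<^sub>R axis i (1::real))"
    by (intro C_k_curve_sum bounded_linear.C_k_curve[OF bounded_linear_scaleR_left] assms)
  also have "(\<lambda>t. \<Sum>i\<in>UNIV. (v t $ i) *\<^sub>R axis i (1::real)) = v"
    using basis_expansion[where 'a=real and 'n='n] by (simp add: scalar_mult_eq_scaleR fun_eq_iff)
  finally show ?thesis .
qed

lemma C_k_on_SucD: "C_k_on (Suc k) K F \<Longrightarrow> C_k_on k K F"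
proof (induction k arbitrary: F)
  case 0
  then show ?case by simp
next
  case (Suc k)
  then show ?case by (metis C_k_on.simps(2))
qed

lemma C_k_on_mono: "C_k_on n K F \<Longrightarrow> k \<le> n \<Longrightarrow> C_k_on k K F"
  by (induction n) (use C_k_on_SucD le_Suc_eq in blast)+

text \<open>
  The chain rule expands the derivative of \<open>F \<circ> v\<close> as the sum of the terms
  \<open>(v' t \<bullet> b) *\<^sub>R DF (v t) b\<close> over the basis vectors \<open>b\<close>. Along the curve, each directional derivative
  \<open>x \<mapsto> DF x b\<close> agrees with a function of class \<open>C\<^sup>k\<close>, to which the induction
  hypothesis applies.
\<close>

lemma C_k_curve_compose:
  fixes F :: "'a::euclidean_space \<Rightarrow> 'b::real_normed_vector"
  assumes in_int: "\<And>t. t \<in> I \<Longrightarrow> v t \<in> interior K"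
  shows "C_k_on k K F \<Longrightarrow> C_k_curve k I v \<Longrightarrow> C_k_curve k I (\<lambda>t. F (v t))"
proof (induction k arbitrary: F)
  case 0
  have "v ` I \<subseteq> K" using in_int interior_subset by blast
  with 0 show ?case
    using continuous_on_compose2[of K F I v] by simp
next
  case (Suc k)
  from Suc.prems(2) obtain v' where
    v': "\<And>t. t \<in> I \<Longrightarrow> (v has_vector_derivative v' t) (at t within I)" "C_k_curve k I v'"
    by auto
  have v: "C_k_curve k I v" using Suc.prems(2) C_k_curve_SucD by blast
  from Suc.prems(1) obtain G where
    G: "\<And>b x. x \<in> interior K \<Longrightarrow> G b x = frechet_derivative F (at x) b" "\<And>b. C_k_on k K (G b)"
    unfolding C_k_on.simps by metis
  let ?w = "\<lambda>t. \<Sum>b\<in>Basis. (v' t \<bullet> b) *\<^sub>R G b (v t)"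
  have "C_k_curve k I ?w"
    by (intro C_k_curve_sum bounded_bilinear.C_k_curve[OF bounded_bilinear_scaleR]
        bounded_linear.C_k_curve[OF bounded_linear_inner_left] v'(2) Suc.IH G(2) v)
  moreover have "((\<lambda>t. F (v t)) has_vector_derivative ?w t) (at t within I)" if t: "t \<in> I" for t
  proof -
    have dF: "(F has_derivative frechet_derivative F (at (v t))) (at (v t))"
      using Suc.prems(1) in_int[OF t] frechet_derivative_works by auto
    interpret DF: bounded_linear "frechet_derivative F (at (v t))"
      using dF has_derivative_bounded_linear by blast
    have "?w t = frechet_derivative F (at (v t)) (\<Sum>b\<in>Basis. (v' t \<bullet> b) *\<^sub>R b)"
      using G(1)[OF in_int[OF t]] by (simp add: DF.sum DF.scaleR)
    also have "\<dots> = frechet_derivative F (at (v t)) (v' t)"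
      by (simp add: euclidean_representation)
    finally have w: "?w t = frechet_derivative F (at (v t)) (v' t)" .
    have "((\<lambda>t. F (v t)) has_derivative
        (\<lambda>h. frechet_derivative F (at (v t)) (h *\<^sub>R v' t))) (at t within I)"
      using has_derivative_compose[OF v'(1)[OF t, unfolded has_vector_derivative_def] dF] .
    then show ?thesis
      unfolding has_vector_derivative_def w by (simp add: DF.scaleR)
  qed
  ultimately show ?case by (auto intro!: exI[of _ ?w])
qed

text \<open>
  Bootstrapping: if the solution is of class \<open>C\<^sup>j\<close>, then so is its derivative \<open>f \<circ> v\<close>, and
  hence the solution is of class \<open>C\<^sup>j\<^sup>+\<^sup>1\<close>, until the smoothness of \<open>f\<close> is exhausted.
\<close>

lemma C_k_curve_ode_solution:
  fixes f :: "'a::euclidean_space \<Rightarrow> 'a"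
  assumes sol: "\<And>t. t \<in> I \<Longrightarrow> (v has_vector_derivative f (v t)) (at t within I)"
    and in_int: "\<And>t. t \<in> I \<Longrightarrow> v t \<in> interior K"
    and smooth: "C_k_on k K f"
  shows "C_k_curve (Suc k) I v"
proof -
  have "j \<le> k \<Longrightarrow> C_k_curve (Suc j) I v" for j
  proof (induction j)
    case 0
    have "C_k_curve 0 I v"
      unfolding C_k_curve.simps continuous_on_eq_continuous_within
      using sol has_vector_derivative_continuous by blast
    have "C_k_curve 0 I (\<lambda>t. f (v t))"
      by (rule C_k_curve_compose[OF in_int C_k_on_mono[OF smooth le0] \<open>C_k_curve 0 I v\<close>])
    with sol show ?case
      unfolding C_k_curve.simps(2)[of 0] by (intro exI[of _ "\<lambda>t. f (v t)"] conjI ballI)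
  next
    case (Suc j)
    then have "C_k_curve (Suc j) I v" "Suc j \<le> k" by auto
    then have "C_k_curve (Suc j) I (\<lambda>t. f (v t))"
      by (intro C_k_curve_compose[OF in_int C_k_on_mono[OF smooth]])
    with sol show ?case
      unfolding C_k_curve.simps(2)[of "Suc j"] by (intro exI[of _ "\<lambda>t. f (v t)"] conjI ballI)
  qed
  then show ?thesis by simp
qed

section \<open>Interpolation and quadrature\<close>

text \<open>
  The induction integrates an expansion of \<open>v'\<close>: a curve whose derivative is at most \<open>C (s - a) ^ k\<close>
  varies by at most \<open>C (x - a) ^ (k + 1)\<close> on \<open>{a..x}\<close>. The factor \<open>1 / (k + 1)\<close> that
  integration would give is dropped, since only the existence of \<open>C\<close>, uniform in the
  expansion point \<open>a\<close>, matters. For \<open>k = 1\<close> the statement is a Lipschitz bound.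
\<close>

lemma C_k_curve_taylor:
  assumes "C_k_curve k {0..T} v"
  shows "\<exists>C\<ge>0. \<forall>a\<ge>0. \<exists>c. \<forall>x\<in>{a..T}.
    norm (v x - (\<Sum>i<k. (x - a) ^ i *\<^sub>R c i)) \<le> C * (x - a) ^ k"
  using assms
proof (induction k arbitrary: v)
  case 0
  then have "bounded (v ` {0..T})"
    by (auto intro: compact_imp_bounded compact_continuous_image)
  then obtain C where "\<forall>x\<in>{0..T}. norm (v x) \<le> C"
    unfolding bounded_iff by auto
  then show ?case
    by (intro exI[of _ "max C 0"]) (force intro: order_trans[OF _ max.cobounded1])
next
  case (Suc k)
  then obtain v' where v': "\<And>t. t \<in> {0..T} \<Longrightarrow> (v has_vector_derivative v' t) (at t within {0..T})"
    "C_k_curve k {0..T} v'"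
    unfolding C_k_curve.simps by blast
  from Suc.IH[OF v'(2)] obtain C where "C \<ge> 0" and C: "\<And>a. a \<ge> 0 \<Longrightarrow> \<exists>c. \<forall>x\<in>{a..T}.
    norm (v' x - (\<Sum>i<k. (x - a) ^ i *\<^sub>R c i)) \<le> C * (x - a) ^ k"
    by blast
  have "\<exists>c. \<forall>x\<in>{a..T}. norm (v x - (\<Sum>i<Suc k. (x - a) ^ i *\<^sub>R c i)) \<le> C * (x - a) ^ Suc k"
    if a: "a \<ge> 0" for a
  proof -
    obtain c where c: "\<And>x. x \<in> {a..T} \<Longrightarrow>
        norm (v' x - (\<Sum>i<k. (x - a) ^ i *\<^sub>R c i)) \<le> C * (x - a) ^ k"
      using C[OF a] by blast
    \<comment> \<open>\<open>d\<close> are the coefficients of the antiderivative with value \<open>v a\<close> at \<open>a\<close>, and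
      \<open>w - w a\<close> is the remainder of \<open>v\<close>.\<close>
    define d where "d = (\<lambda>i. case i of 0 \<Rightarrow> v a | Suc j \<Rightarrow> (1 / real (Suc j)) *\<^sub>R c j)"
    define w where "w = (\<lambda>x. v x - (\<Sum>i<k. ((x - a) ^ Suc i / real (Suc i)) *\<^sub>R c i))"
    have w: "v x - (\<Sum>i<Suc k. (x - a) ^ i *\<^sub>R d i) = w x - w a" for x
      unfolding w_def by (subst sum.lessThan_Suc_shift) (simp add: d_def)
    have "norm (w x - w a) \<le> C * (x - a) ^ Suc k" if x: "x \<in> {a..T}" for x
    proof -
      have dw: "(w has_vector_derivative v' s - (\<Sum>i<k. (s - a) ^ i *\<^sub>R c i)) (at s within {a..x})"
        if s: "s \<in> {a..x}" for s
      proof -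
        have "(v has_vector_derivative v' s) (at s within {a..x})"
          by (rule has_vector_derivative_within_subset[OF v'(1)]) (use a x s in auto)
        moreover have "((\<lambda>x. ((x - a) ^ Suc i / real (Suc i)) *\<^sub>R c i) has_vector_derivative
            (s - a) ^ i *\<^sub>R c i) (at s within {a..x})" for i
        proof -
          have "((\<lambda>x. (x - a) ^ Suc i / real (Suc i)) has_field_derivative (s - a) ^ i)
              (at s within {a..x})"
            by (rule derivative_eq_intros refl)+ (auto simp del: of_nat_Suc)
          from has_vector_derivative_scaleR[OF this has_vector_derivative_const[of "c i"]]
          show ?thesis by simp
        qed
        ultimately show ?thesis
          unfolding w_def
          by (intro has_vector_derivative_diff has_vector_derivative_sum) auto
      qed
      have "norm (w x - w a) \<le> (C * (x - a) ^ k) * norm (x - a)"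
      proof (rule differentiable_bound[where S="{a..x}"])
        show "(w has_derivative (\<lambda>h. h *\<^sub>R (v' s - (\<Sum>i<k. (s - a) ^ i *\<^sub>R c i)))) (at s within {a..x})"
          if "s \<in> {a..x}" for s
          using dw[OF that] unfolding has_vector_derivative_def .
        show "onorm (\<lambda>h. h *\<^sub>R (v' s - (\<Sum>i<k. (s - a) ^ i *\<^sub>R c i))) \<le> C * (x - a) ^ k"
          if s: "s \<in> {a..x}" for s
        proof (rule onorm_le)
          fix h
          have "norm (v' s - (\<Sum>i<k. (s - a) ^ i *\<^sub>R c i)) \<le> C * (s - a) ^ k"
            using c x s by auto
          also have "\<dots> \<le> C * (x - a) ^ k"
            using \<open>C \<ge> 0\<close> s by (intro mult_left_mono power_mono) auto
          finally show "norm (h *\<^sub>R (v' s - (\<Sum>i<k. (s - a) ^ i *\<^sub>R c i))) \<le> C * (x - a) ^ k * norm h"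
            by (simp add: mult.commute mult_left_mono)
        qed
      qed (use x in auto)
      then show ?thesis using x by (simp add: algebra_simps)
    qed
    then show ?thesis unfolding w[symmetric] by blast
  qed
  with \<open>C \<ge> 0\<close> show ?case by blast
qed

lemma lagrange_basis_node:
  assumes "inj_on \<tau> {..M}" "i \<le> M" "j \<le> M"
  shows "lagrange_basis M \<tau> j (\<tau> i) = (if i = j then 1 else 0)"
proof (cases "i = j")
  case True
  have "(\<tau> j - \<tau> k) / (\<tau> j - \<tau> k) = 1" if "k \<in> {..M} - {j}" for k
    using that assms inj_onD[OF assms(1), of j k] by auto
  with True show ?thesis
    by (simp add: lagrange_basis_def)
next
  case False
  with assms show ?thesis
    by (auto simp: lagrange_basis_def intro!: prod_zero bexI[of _ i])
qed

definition lagrange_poly :: "nat \<Rightarrow> (nat \<Rightarrow> real) \<Rightarrow> nat \<Rightarrow> real poly" where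
  "lagrange_poly M \<tau> j =
     (\<Prod>i\<in>{..M} - {j}. [:- \<tau> i / (\<tau> j - \<tau> i), 1 / (\<tau> j - \<tau> i):])"

lemma poly_lagrange_poly: "poly (lagrange_poly M \<tau> j) x = lagrange_basis M \<tau> j x"
  by (simp add: lagrange_poly_def lagrange_basis_def poly_prod diff_divide_distrib)

lemma degree_lagrange_poly_le:
  assumes "j \<le> M"
  shows "degree (lagrange_poly M \<tau> j) \<le> M"
proof -
  have "degree (lagrange_poly M \<tau> j) \<le>
      (\<Sum>i\<in>{..M} - {j}. degree [:- \<tau> i / (\<tau> j - \<tau> i), 1 / (\<tau> j - \<tau> i):])"
    unfolding lagrange_poly_def by (rule degree_prod_sum_le[unfolded comp_def]) simp
  also have "\<dots> \<le> (\<Sum>i\<in>{..M} - {j}. 1)"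
    by (intro sum_mono) simp
  also have "\<dots> = M" using assms by simp
  finally show ?thesis .
qed

text \<open>
  Both sides are polynomials of degree at most \<open>M\<close> in \<open>x\<close>, and they agree at the \<open>M + 1\<close> nodes.
\<close>

lemma lagrange_interpolation_power:
  assumes inj: "inj_on \<tau> {..M}" and "k \<le> M"
  shows "(\<Sum>j\<le>M. lagrange_basis M \<tau> j x * \<tau> j ^ k) = x ^ k"
proof -
  define R where "R = (\<Sum>j\<le>M. smult (\<tau> j ^ k) (lagrange_poly M \<tau> j))"
  have R: "poly R x = (\<Sum>j\<le>M. lagrange_basis M \<tau> j x * \<tau> j ^ k)" for x
    unfolding R_def poly_sum by (simp add: poly_lagrange_poly mult.commute)
  have "R = monom 1 k"
  proof (rule poly_eqI_degree[of "\<tau> ` {..M}"])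
    fix x assume "x \<in> \<tau> ` {..M}"
    then obtain i where i: "i \<le> M" "x = \<tau> i" by auto
    have "poly R x = (\<Sum>j\<le>M. if i = j then \<tau> j ^ k else 0)"
      unfolding R i(2) by (intro sum.cong) (auto simp: lagrange_basis_node[OF inj i(1)])
    then show "poly R x = poly (monom 1 k) x"
      using i by (simp add: poly_monom)
  next
    have "degree R \<le> M"
      unfolding R_def by (intro degree_sum_le) (auto intro!: order_trans[OF degree_smult_le] degree_lagrange_poly_le)
    then show "degree R < card (\<tau> ` {..M})"
      using inj by (simp add: card_image)
    show "degree (monom (1::real) k) < card (\<tau> ` {..M})"
      using inj \<open>k \<le> M\<close> by (simp add: card_image degree_monom_eq)
  qed
  then show ?thesis using R[of x] by (simp add: poly_monom)
qed

lemma continuous_on_lagrange_basis: "continuous_on S (lagrange_basis M \<tau> j)"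
  unfolding lagrange_basis_def divide_inverse by (intro continuous_intros)

text \<open>
  Interpolation is linear and reproduces the Taylor polynomial of degree \<open>M\<close> at \<open>t\<close>. Therefore
  the error only sees the Taylor remainder \<open>R\<close>, and it is at most the bound of \<open>R\<close> times one plus the
  sum of the bounds of the Lagrange basis polynomials on \<open>{0..1}\<close>.
\<close>

lemma interpolation_error:
  fixes v :: "real \<Rightarrow> 'a::real_normed_vector"
  assumes inj: "inj_on \<tau> {..M}" and nodes: "\<And>j. j \<le> M \<Longrightarrow> 0 \<le> \<tau> j \<and> \<tau> j \<le> 1"
    and smooth: "C_k_curve (Suc M) {0..T} v"
  shows "\<exists>C\<ge>0. \<forall>t h s. 0 \<le> t \<and> 0 \<le> h \<and> t + h \<le> T \<and> 0 \<le> s \<and> s \<le> 1 \<longrightarrow>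
    norm (v (t + s * h) - (\<Sum>j\<le>M. lagrange_basis M \<tau> j s *\<^sub>R v (t + \<tau> j * h))) \<le> C * h ^ Suc M"
proof -
  obtain C where "C \<ge> 0" and C: "\<And>a. a \<ge> 0 \<Longrightarrow> \<exists>c. \<forall>x\<in>{a..T}.
      norm (v x - (\<Sum>i<Suc M. (x - a) ^ i *\<^sub>R c i)) \<le> C * (x - a) ^ Suc M"
    using C_k_curve_taylor[OF smooth] by blast
  have "\<forall>j. \<exists>B. \<forall>s\<in>{0..1}. \<bar>lagrange_basis M \<tau> j s\<bar> \<le> B"
  proof
    fix j
    have "bounded (lagrange_basis M \<tau> j ` {0..1})"
      by (intro compact_imp_bounded compact_continuous_image continuous_on_lagrange_basis) simp
    then show "\<exists>B. \<forall>s\<in>{0..1}. \<bar>lagrange_basis M \<tau> j s\<bar> \<le> B"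
      unfolding bounded_iff by auto
  qed
  then obtain B where B: "\<And>j s. s \<in> {0..1} \<Longrightarrow> \<bar>lagrange_basis M \<tau> j s\<bar> \<le> B j"
    by metis
  have B0: "0 \<le> B j" for j using B[of 0 j] by simp
  define K where "K = (1 + (\<Sum>j\<le>M. B j)) * C"
  have "norm (v (t + s * h) - (\<Sum>j\<le>M. lagrange_basis M \<tau> j s *\<^sub>R v (t + \<tau> j * h))) \<le> K * h ^ Suc M"
    if th: "0 \<le> t" "0 \<le> h" "t + h \<le> T" "0 \<le> s" "s \<le> 1" for t h s
  proof -
    obtain c where c: "\<And>x. x \<in> {t..T} \<Longrightarrow>
        norm (v x - (\<Sum>i<Suc M. (x - t) ^ i *\<^sub>R c i)) \<le> C * (x - t) ^ Suc M"
      using C[OF th(1)] by blast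
    define P where "P = (\<lambda>s. \<Sum>i<Suc M. (s * h) ^ i *\<^sub>R c i)"
    define R where "R = (\<lambda>s. v (t + s * h) - P s)"
    have R: "norm (R s) \<le> C * h ^ Suc M" if "0 \<le> s" "s \<le> 1" for s
    proof -
      have "s * h \<le> h" using that th by (simp add: mult_left_le_one_le)
      then have "norm (R s) \<le> C * (s * h) ^ Suc M"
        using c[of "t + s * h"] that th unfolding R_def P_def by simp
      also have "\<dots> \<le> C * h ^ Suc M"
        using \<open>s * h \<le> h\<close> that th \<open>C \<ge> 0\<close> by (intro mult_left_mono power_mono) auto
      finally show ?thesis .
    qed
    have exact: "(\<Sum>j\<le>M. lagrange_basis M \<tau> j s *\<^sub>R P (\<tau> j)) = P s"
    proof -
      have "(\<Sum>j\<le>M. lagrange_basis M \<tau> j s *\<^sub>R P (\<tau> j)) =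
          (\<Sum>i<Suc M. (\<Sum>j\<le>M. lagrange_basis M \<tau> j s * \<tau> j ^ i) *\<^sub>R (h ^ i *\<^sub>R c i))"
        unfolding P_def scaleR_sum_right scaleR_sum_left
        by (subst sum.swap) (simp add: power_mult_distrib mult.assoc)
      also have "\<dots> = (\<Sum>i<Suc M. s ^ i *\<^sub>R (h ^ i *\<^sub>R c i))"
        by (intro sum.cong) (auto simp: lagrange_interpolation_power[OF inj])
      finally show ?thesis by (simp add: P_def power_mult_distrib)
    qed
    have "v (t + s * h) - (\<Sum>j\<le>M. lagrange_basis M \<tau> j s *\<^sub>R v (t + \<tau> j * h)) =
        R s - (\<Sum>j\<le>M. lagrange_basis M \<tau> j s *\<^sub>R R (\<tau> j))"
      unfolding R_def scaleR_diff_right sum_subtractf exact by simp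
    also have "norm \<dots> \<le> norm (R s) + (\<Sum>j\<le>M. norm (lagrange_basis M \<tau> j s *\<^sub>R R (\<tau> j)))"
      by (rule order_trans[OF norm_triangle_ineq4 add_left_mono[OF norm_sum]])
    also have "\<dots> \<le> C * h ^ Suc M + (\<Sum>j\<le>M. B j * (C * h ^ Suc M))"
      using th nodes B[of s] B0 by (intro add_mono sum_mono) (auto intro!: mult_mono R simp del: power_Suc)
    also have "\<dots> = K * h ^ Suc M"
      unfolding K_def sum_distrib_right[symmetric] by (simp add: algebra_simps)
    finally show ?thesis .
  qed
  moreover have "K \<ge> 0" unfolding K_def using \<open>C \<ge> 0\<close> B0 by (simp add: sum_nonneg)
  ultimately show ?thesis by blast
qed

text \<open>
  The increment of \<open>u\<close> is the integral of its derivative \<open>v\<close>, the quadrature sum is the integral of the polynomial that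
  interpolates \<open>v\<close>, and the substitution to the unit interval contributes one more factor \<open>h\<close> to the
  interpolation error.
\<close>

lemma collocation_residual:
  fixes u :: "real \<Rightarrow> 'a::banach"
  assumes inj: "inj_on \<tau> {..M}" and nodes: "\<And>j. j \<le> M \<Longrightarrow> 0 \<le> \<tau> j \<and> \<tau> j \<le> 1"
    and deriv: "\<And>t. t \<in> {0..T} \<Longrightarrow> (u has_vector_derivative v t) (at t within {0..T})"
    and smooth: "C_k_curve (Suc M) {0..T} v"
  shows "\<exists>C\<ge>0. \<forall>t h. \<forall>m\<le>M. 0 \<le> t \<and> 0 \<le> h \<and> t + h \<le> T \<longrightarrow>
    norm (u (t + \<tau> m * h) - u t - h *\<^sub>R (\<Sum>j\<le>M. quad_weight M \<tau> m j *\<^sub>R v (t + \<tau> j * h)))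
      \<le> C * h ^ (M + 2)"
proof -
  obtain C where "C \<ge> 0" and C: "\<And>t h s. 0 \<le> t \<Longrightarrow> 0 \<le> h \<Longrightarrow> t + h \<le> T \<Longrightarrow> 0 \<le> s \<Longrightarrow> s \<le> 1 \<Longrightarrow>
    norm (v (t + s * h) - (\<Sum>j\<le>M. lagrange_basis M \<tau> j s *\<^sub>R v (t + \<tau> j * h))) \<le> C * h ^ Suc M"
    using interpolation_error[OF inj nodes smooth] by blast
  have "norm (u (t + \<tau> m * h) - u t - h *\<^sub>R (\<Sum>j\<le>M. quad_weight M \<tau> m j *\<^sub>R v (t + \<tau> j * h)))
      \<le> C * h ^ (M + 2)" if th: "0 \<le> t" "0 \<le> h" "t + h \<le> T" and m: "m \<le> M" for t h m
  proof -
    have \<tau>m: "0 \<le> \<tau> m" "\<tau> m \<le> 1" using nodes m by auto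
    have sh: "s * h \<in> {0..h}" if "s \<in> {0..\<tau> m}" for s
      using that \<tau>m th by (auto intro: mult_left_le_one_le)
    have exact: "((\<lambda>s. h *\<^sub>R v (t + s * h)) has_integral u (t + \<tau> m * h) - u t) {0..\<tau> m}"
    proof -
      have "((\<lambda>s. h *\<^sub>R v (t + s * h)) has_integral u (t + \<tau> m * h) - u (t + 0 * h)) {0..\<tau> m}"
      proof (rule fundamental_theorem_of_calculus[OF \<tau>m(1)])
        fix s assume s: "s \<in> {0..\<tau> m}"
        have "((\<lambda>s. t + s * h) has_vector_derivative h) (at s within {0..\<tau> m})"
          by (auto intro!: derivative_eq_intros simp: has_real_derivative_iff_has_vector_derivative[symmetric])
        moreover have "(u has_vector_derivative v (t + s * h))
            (at (t + s * h) within (\<lambda>s. t + s * h) ` {0..\<tau> m})"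
          using sh s th by (intro has_vector_derivative_within_subset[OF deriv]) (fastforce)+
        ultimately show "((\<lambda>s. u (t + s * h)) has_vector_derivative h *\<^sub>R v (t + s * h))
            (at s within {0..\<tau> m})"
          using vector_diff_chain_within by (fastforce simp: o_def)
      qed
      then show ?thesis by simp
    qed
    have quad: "((\<lambda>s. h *\<^sub>R (\<Sum>j\<le>M. lagrange_basis M \<tau> j s *\<^sub>R v (t + \<tau> j * h))) has_integral
        h *\<^sub>R (\<Sum>j\<le>M. quad_weight M \<tau> m j *\<^sub>R v (t + \<tau> j * h))) {0..\<tau> m}"
      unfolding quad_weight_def
      by (intro has_integral_cmul has_integral_sum has_integral_scaleR_left integrable_integral
          integrable_continuous_interval continuous_on_lagrange_basis) auto
    have "norm (u (t + \<tau> m * h) - u t - h *\<^sub>R (\<Sum>j\<le>M. quad_weight M \<tau> m j *\<^sub>R v (t + \<tau> j * h)))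
        \<le> (C * h ^ (M + 2)) * measure lborel {0..\<tau> m}"
    proof (rule has_integral_bound_real[OF _ _ has_integral_diff[OF exact quad], where S="{}"])
      fix s assume "s \<in> {0..\<tau> m} - {}"
      then have "norm (v (t + s * h) - (\<Sum>j\<le>M. lagrange_basis M \<tau> j s *\<^sub>R v (t + \<tau> j * h)))
          \<le> C * h ^ Suc M"
        using \<tau>m th by (intro C) auto
      then have "h * norm (v (t + s * h) - (\<Sum>j\<le>M. lagrange_basis M \<tau> j s *\<^sub>R v (t + \<tau> j * h)))
          \<le> h * (C * h ^ Suc M)"
        using th by (intro mult_left_mono)
      then show "norm (h *\<^sub>R v (t + s * h) - h *\<^sub>R (\<Sum>j\<le>M. lagrange_basis M \<tau> j s *\<^sub>R v (t + \<tau> j * h)))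
          \<le> C * h ^ (M + 2)"
        using th by (simp add: scaleR_diff_right[symmetric] mult_ac)
    qed (use \<open>C \<ge> 0\<close> th in auto)
    also have "\<dots> \<le> C * h ^ (M + 2)"
      using \<tau>m \<open>C \<ge> 0\<close> th by (intro mult_left_le) auto
    finally show ?thesis .
  qed
  with \<open>C \<ge> 0\<close> show ?thesis by blast
qed

lemma euler_residual:
  fixes u :: "real \<Rightarrow> 'a::real_normed_vector"
  assumes deriv: "\<And>t. t \<in> {0..T} \<Longrightarrow> (u has_vector_derivative v t) (at t within {0..T})"
    and smooth: "C_k_curve 1 {0..T} v"
  shows "\<exists>C\<ge>0. \<forall>t d. 0 \<le> t \<and> 0 \<le> d \<and> t + d \<le> T \<longrightarrow> norm (u (t + d) - u t - d *\<^sub>R v t) \<le> C * d\<^sup>2"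
proof -
  obtain C where "C \<ge> 0" and C: "\<And>a. a \<ge> 0 \<Longrightarrow> \<exists>c. \<forall>x\<in>{a..T}. norm (v x - c) \<le> C * (x - a)"
    using C_k_curve_taylor[OF smooth] by (force simp: lessThan_Suc)
  have "norm (u (t + d) - u t - d *\<^sub>R v t) \<le> C * d\<^sup>2" if td: "0 \<le> t" "0 \<le> d" "t + d \<le> T" for t d
  proof -
    obtain c where c: "\<And>x. x \<in> {t..T} \<Longrightarrow> norm (v x - c) \<le> C * (x - t)"
      using C[OF td(1)] by blast
    have "c = v t" using c[of t] td by simp
    have "norm (u (t + d) - u t - (t + d - t) *\<^sub>R v t) \<le> norm (t + d - t) * (C * d)"
    proof (rule vector_differentiable_bound_linearization[where S="{t..t + d}"])
      show "(u has_vector_derivative v x) (at x within {t..t + d})" if "x \<in> {t..t + d}" for x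
        using that td by (intro has_vector_derivative_within_subset[OF deriv]) auto
      show "norm (v x - v t) \<le> C * d" if "x \<in> {t..t + d}" for x
      proof -
        have "norm (v x - v t) \<le> C * (x - t)" using c[of x] that td \<open>c = v t\<close> by simp
        also have "\<dots> \<le> C * d" using that \<open>C \<ge> 0\<close> by (intro mult_left_mono) auto
        finally show ?thesis .
      qed
    qed (use td in \<open>auto simp: closed_segment_eq_real_ivl\<close>)
    then show ?thesis using td by (simp add: power2_eq_square mult_ac)
  qed
  with \<open>C \<ge> 0\<close> show ?thesis by blast
qed

section \<open>Picard sweeps\<close>

text \<open>
  The correction sweeps for \<open>u' = g u\<close> in the unknown \<open>u\<close> itself: explicit Euler predictions,
  followed by Picard iterations for the collocation equations. SPIDeC is this iteration in logarithmic
  variables.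
\<close>

fun picard_sweep ::
    "nat \<Rightarrow> (nat \<Rightarrow> real) \<Rightarrow> ('a::real_normed_vector \<Rightarrow> 'a) \<Rightarrow> real \<Rightarrow> 'a \<Rightarrow> nat \<Rightarrow> nat \<Rightarrow> 'a" where
  "picard_sweep M \<tau> g h w 0 m = w + (h * \<tau> m) *\<^sub>R g w"
| "picard_sweep M \<tau> g h w (Suc k) m =
     w + h *\<^sub>R (\<Sum>j\<le>M. quad_weight M \<tau> m j *\<^sub>R g (picard_sweep M \<tau> g h w k j))"

text \<open>
  Each sweep gains one power of \<open>h\<close> in the stage errors. If the previous stages are within \<open>E\<close> of the
  exact solution, the new ones are within the initial error, plus \<open>h\<close> times a multiple of \<open>E\<close>,
  plus the collocation residual; the residual stops the gain at \<open>h ^ (M + 2)\<close>. The initial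
  error \<open>w - u t\<close> enters with factor \<open>1 + O(h)\<close>, which is what makes the method stable.

  The field \<open>g\<close> is only compared with its values on the exact trajectory, within a distance \<open>r\<close>. That
  is why the estimate asks for a small step and a small initial error: the threshold \<open>\<epsilon>\<close> keeps the
  stages at which \<open>g\<close> is evaluated within distance \<open>r\<close>.
\<close>

lemma picard_sweep_error:
  fixes u :: "real \<Rightarrow> 'a::banach"
  assumes inj: "inj_on \<tau> {..M}" and nodes: "\<And>j. j \<le> M \<Longrightarrow> 0 \<le> \<tau> j \<and> \<tau> j \<le> 1"
    and deriv: "\<And>t. t \<in> {0..T} \<Longrightarrow> (u has_vector_derivative g (u t)) (at t within {0..T})"
    and smooth: "C_k_curve (Suc M) {0..T} (\<lambda>t. g (u t))"
    and "0 < r" "0 \<le> L"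
    and lip: "\<And>t x. t \<in> {0..T} \<Longrightarrow> norm (x - u t) \<le> r \<Longrightarrow>
      norm (g x - g (u t)) \<le> L * norm (x - u t)"
  shows "\<exists>A\<ge>0. \<exists>C\<ge>0. \<exists>\<epsilon>>0. \<forall>h t w. \<forall>m\<le>M.
    0 < h \<and> h \<le> \<epsilon> \<and> 0 \<le> t \<and> t + h \<le> T \<and> norm (w - u t) \<le> \<epsilon> \<longrightarrow>
    norm (picard_sweep M \<tau> g h w k m - u (t + \<tau> m * h)) \<le>
      (1 + A * h) * norm (w - u t) + C * h ^ (min k M + 2)"
proof (induction k)
  case 0
  have "C_k_curve 1 {0..T} (\<lambda>t. g (u t))"
    by (rule C_k_curve_mono[OF smooth]) simp
  then obtain C where "C \<ge> 0" and C: "\<And>t d. 0 \<le> t \<Longrightarrow> 0 \<le> d \<Longrightarrow> t + d \<le> T \<Longrightarrow>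
      norm (u (t + d) - u t - d *\<^sub>R g (u t)) \<le> C * d\<^sup>2"
    using euler_residual[OF deriv] by blast
  have est: "\<forall>h t w. \<forall>m\<le>M.
      0 < h \<and> h \<le> r \<and> 0 \<le> t \<and> t + h \<le> T \<and> norm (w - u t) \<le> r \<longrightarrow>
      norm (picard_sweep M \<tau> g h w 0 m - u (t + \<tau> m * h)) \<le>
        (1 + L * h) * norm (w - u t) + C * h ^ (min 0 M + 2)"
  proof (intro allI impI, elim conjE)
    fix h t w m
    assume m: "m \<le> M" and h: "0 < h" "h \<le> r" and t: "0 \<le> t" "t + h \<le> T"
      and w: "norm (w - u t) \<le> r"
    let ?d = "\<tau> m * h"
    have d: "0 \<le> ?d" "?d \<le> h"
      using nodes[OF m] h by (auto intro: mult_left_le_one_le)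
    have "picard_sweep M \<tau> g h w 0 m - u (t + ?d) =
        (w - u t) + ?d *\<^sub>R (g w - g (u t)) - (u (t + ?d) - u t - ?d *\<^sub>R g (u t))"
      by (simp add: algebra_simps)
    also have "norm \<dots> \<le> norm (w - u t) + norm (?d *\<^sub>R (g w - g (u t))) +
        norm (u (t + ?d) - u t - ?d *\<^sub>R g (u t))"
      by (intro order_trans[OF norm_triangle_ineq4] add_right_mono norm_triangle_ineq)
    also have "\<dots> \<le> norm (w - u t) + h * (L * norm (w - u t)) + C * h\<^sup>2"
    proof (intro add_mono order_refl)
      show "norm (?d *\<^sub>R (g w - g (u t))) \<le> h * (L * norm (w - u t))"
        unfolding norm_scaleR using lip[of t w] t w d h by (intro mult_mono) auto
      have "norm (u (t + ?d) - u t - ?d *\<^sub>R g (u t)) \<le> C * ?d\<^sup>2"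
        using C[of t ?d] t d by simp
      also have "\<dots> \<le> C * h\<^sup>2"
        using \<open>C \<ge> 0\<close> d by (intro mult_left_mono power_mono) auto
      finally show "norm (u (t + ?d) - u t - ?d *\<^sub>R g (u t)) \<le> C * h\<^sup>2" .
    qed
    finally show "norm (picard_sweep M \<tau> g h w 0 m - u (t + \<tau> m * h)) \<le>
        (1 + L * h) * norm (w - u t) + C * h ^ (min 0 M + 2)"
      by (simp add: algebra_simps power2_eq_square)
  qed
  show ?case
    by (intro exI[of _ L] exI[of _ C] exI[of _ r] conjI est \<open>C \<ge> 0\<close> \<open>0 < r\<close> \<open>0 \<le> L\<close>)
next
  case (Suc k)
  then obtain A C \<epsilon> where "A \<ge> 0" "C \<ge> 0" "\<epsilon> > 0" and IH:
    "\<forall>h t w. \<forall>m\<le>M.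
      0 < h \<and> h \<le> \<epsilon> \<and> 0 \<le> t \<and> t + h \<le> T \<and> norm (w - u t) \<le> \<epsilon> \<longrightarrow>
      norm (picard_sweep M \<tau> g h w k m - u (t + \<tau> m * h)) \<le>
        (1 + A * h) * norm (w - u t) + C * h ^ (min k M + 2)"
    by (elim exE conjE) (rule that)
  obtain R where "R \<ge> 0" and R: "\<And>t h m. m \<le> M \<Longrightarrow> 0 \<le> t \<Longrightarrow> 0 \<le> h \<Longrightarrow> t + h \<le> T \<Longrightarrow>
      norm (u (t + \<tau> m * h) - u t - h *\<^sub>R (\<Sum>j\<le>M. quad_weight M \<tau> m j *\<^sub>R g (u (t + \<tau> j * h))))
        \<le> R * h ^ (M + 2)"
    using collocation_residual[OF inj nodes deriv smooth] by blast
  define W where "W = (\<Sum>m\<le>M. \<Sum>j\<le>M. \<bar>quad_weight M \<tau> m j\<bar>)"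
  have "W \<ge> 0" unfolding W_def by (intro sum_nonneg) auto
  have W: "(\<Sum>j\<le>M. \<bar>quad_weight M \<tau> m j\<bar>) \<le> W" if "m \<le> M" for m
    unfolding W_def using that
    by (intro member_le_sum[of m "{..M}" "\<lambda>m. \<Sum>j\<le>M. \<bar>quad_weight M \<tau> m j\<bar>"]) (auto intro: sum_nonneg)
  \<comment> \<open>This choice keeps the error of the preceding stages, at most \<open>(1 + A) \<epsilon>' + C \<epsilon>'\<close>, within \<open>r\<close>.\<close>
  define \<epsilon>' where "\<epsilon>' = min (min \<epsilon> 1) (r / (1 + A + C))"
  have "\<epsilon>' > 0"
    unfolding \<epsilon>'_def using \<open>A \<ge> 0\<close> \<open>C \<ge> 0\<close> \<open>\<epsilon> > 0\<close> \<open>0 < r\<close> by simp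
  have \<epsilon>': "\<epsilon>' \<le> \<epsilon>" "\<epsilon>' \<le> 1" "(1 + A + C) * \<epsilon>' \<le> r"
  proof -
    have "\<epsilon>' \<le> r / (1 + A + C)" unfolding \<epsilon>'_def by simp
    then show "(1 + A + C) * \<epsilon>' \<le> r"
      using \<open>A \<ge> 0\<close> \<open>C \<ge> 0\<close> by (simp add: pos_le_divide_eq mult.commute)
  qed (auto simp: \<epsilon>'_def)
  have est: "\<forall>h t w. \<forall>m\<le>M.
      0 < h \<and> h \<le> \<epsilon>' \<and> 0 \<le> t \<and> t + h \<le> T \<and> norm (w - u t) \<le> \<epsilon>' \<longrightarrow>
      norm (picard_sweep M \<tau> g h w (Suc k) m - u (t + \<tau> m * h)) \<le>
        (1 + W * L * (1 + A) * h) * norm (w - u t) + (W * L * C + R) * h ^ (min (Suc k) M + 2)"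
  proof (intro allI impI, elim conjE)
    fix h t w m
    assume m: "m \<le> M" and h: "0 < h" "h \<le> \<epsilon>'" and t: "0 \<le> t" "t + h \<le> T"
      and w: "norm (w - u t) \<le> \<epsilon>'"
    let ?e = "norm (w - u t)" and ?U = "picard_sweep M \<tau> g h w k" and ?u = "\<lambda>j. u (t + \<tau> j * h)"
    let ?E = "(1 + A) * ?e + C * h ^ (min k M + 2)"
    have h1: "h \<le> 1" using h \<epsilon>' by simp
    have E: "norm (?U j - ?u j) \<le> ?E" if j: "j \<le> M" for j
    proof -
      have "norm (?U j - ?u j) \<le> (1 + A * h) * ?e + C * h ^ (min k M + 2)"
        using IH[rule_format, OF j, of h t w] h t w \<epsilon>' by simp
      also have "\<dots> \<le> ?E"
        using h1 \<open>A \<ge> 0\<close> by (intro add_right_mono mult_right_mono) (auto intro: mult_left_le)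
      finally show ?thesis .
    qed
    have "?E \<le> (1 + A) * \<epsilon>' + C * \<epsilon>'"
    proof (intro add_mono mult_left_mono)
      have "h ^ (min k M + 2) \<le> h ^ 1"
        using h h1 by (intro power_decreasing) auto
      then show "h ^ (min k M + 2) \<le> \<epsilon>'"
        using h(2) unfolding power_one_right by (rule order_trans)
    qed (use w \<open>A \<ge> 0\<close> \<open>C \<ge> 0\<close> in auto)
    also have "\<dots> \<le> r" using \<epsilon>'(3) by (simp add: algebra_simps)
    finally have "?E \<le> r" .
    have G: "norm (g (?U j) - g (?u j)) \<le> L * ?E" if j: "j \<le> M" for j
    proof -
      have "\<tau> j * h \<le> h" "0 \<le> \<tau> j * h" using nodes[OF j] h by (auto intro: mult_left_le_one_le)
      then have "norm (g (?U j) - g (?u j)) \<le> L * norm (?U j - ?u j)"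
        using E[OF j] \<open>?E \<le> r\<close> t by (intro lip) auto
      also have "\<dots> \<le> L * ?E" using E[OF j] \<open>0 \<le> L\<close> by (intro mult_left_mono)
      finally show ?thesis .
    qed
    have E0: "0 \<le> ?E" using E[OF le0] norm_ge_zero order_trans by blast
    have sum: "norm (\<Sum>j\<le>M. quad_weight M \<tau> m j *\<^sub>R (g (?U j) - g (?u j))) \<le> W * (L * ?E)"
    proof -
      have "norm (\<Sum>j\<le>M. quad_weight M \<tau> m j *\<^sub>R (g (?U j) - g (?u j))) \<le>
          (\<Sum>j\<le>M. \<bar>quad_weight M \<tau> m j\<bar> * (L * ?E))"
        using G by (intro sum_norm_le) (auto intro!: mult_left_mono)
      also have "\<dots> = (\<Sum>j\<le>M. \<bar>quad_weight M \<tau> m j\<bar>) * (L * ?E)"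
        by (simp only: sum_distrib_right)
      also have "\<dots> \<le> W * (L * ?E)"
        using W[OF m] \<open>0 \<le> L\<close> E0 by (intro mult_right_mono) auto
      finally show ?thesis .
    qed
    have split: "picard_sweep M \<tau> g h w (Suc k) m - ?u m =
        (w - u t) + h *\<^sub>R (\<Sum>j\<le>M. quad_weight M \<tau> m j *\<^sub>R (g (?U j) - g (?u j))) -
        (?u m - u t - h *\<^sub>R (\<Sum>j\<le>M. quad_weight M \<tau> m j *\<^sub>R g (?u j)))"
      by (simp add: scaleR_diff_right sum_subtractf algebra_simps)
    have "norm (picard_sweep M \<tau> g h w (Suc k) m - ?u m) \<le> ?e +
        norm (h *\<^sub>R (\<Sum>j\<le>M. quad_weight M \<tau> m j *\<^sub>R (g (?U j) - g (?u j)))) +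
        norm (?u m - u t - h *\<^sub>R (\<Sum>j\<le>M. quad_weight M \<tau> m j *\<^sub>R g (?u j)))"
      unfolding split
      by (intro order_trans[OF norm_triangle_ineq4] add_right_mono norm_triangle_ineq)
    also have "\<dots> \<le> ?e + h * (W * (L * ?E)) + R * h ^ (M + 2)"
      using sum R[OF m, of t h] h t by (intro add_mono order_refl) (auto intro: mult_left_mono)
    also have "\<dots> = (1 + W * L * (1 + A) * h) * ?e + W * L * C * h ^ (min k M + 3) + R * h ^ (M + 2)"
      by (simp add: algebra_simps eval_nat_numeral)
    also have "\<dots> \<le> (1 + W * L * (1 + A) * h) * ?e + W * L * C * h ^ (min (Suc k) M + 2) +
        R * h ^ (min (Suc k) M + 2)"
    proof (intro add_mono order_refl mult_left_mono)
      have "min (Suc k) M + 2 \<le> min k M + 3" by arith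
      then show "h ^ (min k M + 3) \<le> h ^ (min (Suc k) M + 2)"
        using h h1 by (intro power_decreasing) auto
      show "h ^ (M + 2) \<le> h ^ (min (Suc k) M + 2)"
        using h h1 by (intro power_decreasing) auto
    qed (use \<open>W \<ge> 0\<close> \<open>0 \<le> L\<close> \<open>C \<ge> 0\<close> \<open>R \<ge> 0\<close> in auto)
    finally show "norm (picard_sweep M \<tau> g h w (Suc k) m - ?u m) \<le>
        (1 + W * L * (1 + A) * h) * ?e + (W * L * C + R) * h ^ (min (Suc k) M + 2)"
      by (simp add: distrib_right)
  qed
  have "0 \<le> W * L * (1 + A)" "0 \<le> W * L * C + R"
    using \<open>W \<ge> 0\<close> \<open>0 \<le> L\<close> \<open>A \<ge> 0\<close> \<open>C \<ge> 0\<close> \<open>R \<ge> 0\<close> by auto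
  with est \<open>\<epsilon>' > 0\<close> show ?case
    by (intro exI[of _ "W * L * (1 + A)"] exI[of _ "W * L * C + R"] exI[of _ \<epsilon>'] conjI)
qed

text \<open>
  The discrete Gronwall argument. After \<open>n\<close> steps the error is at most
  \<open>n h C h ^ p (1 + A h) ^ n\<close>, hence at most \<open>T C exp (A T) h ^ p\<close>. Since the one-step estimate holds
  only near the trajectory, the induction must also keep the error below \<open>\<epsilon>\<close>; this is so once \<open>h\<close> is
  small enough for the final bound to be below \<open>\<epsilon>\<close>, which uses \<open>0 < p\<close>.
\<close>

lemma one_step_convergence:
  fixes \<Phi> :: "real \<Rightarrow> 'a::real_normed_vector \<Rightarrow> 'a" and u :: "real \<Rightarrow> 'a"
  assumes "0 < T" "0 \<le> A" "0 \<le> C" "0 < \<epsilon>" "0 < p"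
    and step: "\<And>h t w. 0 < h \<Longrightarrow> h \<le> \<epsilon> \<Longrightarrow> 0 \<le> t \<Longrightarrow> t + h \<le> T \<Longrightarrow> norm (w - u t) \<le> \<epsilon> \<Longrightarrow>
      norm (\<Phi> h w - u (t + h)) \<le> (1 + A * h) * norm (w - u t) + C * h ^ Suc p"
  shows "\<exists>K\<ge>0. \<forall>\<^sub>F N in sequentially. \<forall>n\<le>N.
    norm ((\<Phi> (T / real N) ^^ n) (u 0) - u (real n * (T / real N))) \<le> K * (T / real N) ^ p"
proof -
  define K where "K = T * C * exp (A * T)"
  have "K \<ge> 0" unfolding K_def using assms by simp
  have h0: "(\<lambda>N. T / real N) \<longlonglongrightarrow> 0"
    by (rule lim_const_over_n)
  have "(\<lambda>N. K * (T / real N) ^ p) \<longlonglongrightarrow> 0"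
    using tendsto_mult[OF tendsto_const[of K] tendsto_power[OF h0, of p]] \<open>0 < p\<close>
    by (simp add: zero_power)
  then have "\<forall>\<^sub>F N in sequentially. K * (T / real N) ^ p < \<epsilon>"
    using \<open>0 < \<epsilon>\<close> order_tendstoD(2) by blast
  moreover have "\<forall>\<^sub>F N in sequentially. T / real N < \<epsilon>"
    using h0 \<open>0 < \<epsilon>\<close> order_tendstoD(2) by blast
  ultimately have "\<forall>\<^sub>F N in sequentially. \<forall>n\<le>N.
    norm ((\<Phi> (T / real N) ^^ n) (u 0) - u (real n * (T / real N))) \<le> K * (T / real N) ^ p"
    using eventually_gt_at_top[of 0]
  proof eventually_elim
    case (elim N)
    define h where "h = T / real N"
    have h: "0 < h" "h < \<epsilon>" "K * h ^ p < \<epsilon>" "real N * h = T"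
      using elim \<open>0 < T\<close> by (auto simp: h_def)
    have nh: "real n * h \<le> T" if "n \<le> N" for n
      using that h(1) h(4)[symmetric] by simp
    have grow: "real n * h * C * h ^ p * (1 + A * h) ^ n \<le> K * h ^ p" if "n \<le> N" for n
    proof -
      have "(1 + A * h) ^ n \<le> exp (A * h) ^ n"
        using \<open>0 \<le> A\<close> h by (intro power_mono exp_ge_add_one_self) auto
      also have "\<dots> = exp (A * (real n * h))" by (simp add: exp_of_nat_mult[symmetric] mult_ac)
      also have "\<dots> \<le> exp (A * T)" using nh[OF that] \<open>0 \<le> A\<close> by (simp add: mult_left_mono)
      finally have "real n * h * C * h ^ p * (1 + A * h) ^ n \<le> T * C * h ^ p * exp (A * T)"
        using nh[OF that] h \<open>0 < T\<close> \<open>0 \<le> C\<close> \<open>0 \<le> A\<close> by (intro mult_mono) auto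
      then show ?thesis unfolding K_def by (simp add: mult_ac)
    qed
    have "norm ((\<Phi> h ^^ n) (u 0) - u (real n * h)) \<le> real n * h * C * h ^ p * (1 + A * h) ^ n"
      if "n \<le> N" for n
      using that
    proof (induction n)
      case 0
      then show ?case by simp
    next
      case (Suc n)
      let ?w = "(\<Phi> h ^^ n) (u 0)" and ?t = "real n * h"
      have IH: "norm (?w - u ?t) \<le> real n * h * C * h ^ p * (1 + A * h) ^ n"
        using Suc by simp
      have "norm (?w - u ?t) \<le> \<epsilon>"
        using IH grow[of n] Suc.prems h(3) by simp
      moreover have th: "?t + h = real (Suc n) * h" by (simp add: algebra_simps)
      ultimately have "norm (\<Phi> h ?w - u (?t + h)) \<le> (1 + A * h) * norm (?w - u ?t) + C * h ^ Suc p"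
        using nh[OF Suc.prems] h by (intro step) auto
      also have "\<dots> \<le> (1 + A * h) * (real n * h * C * h ^ p * (1 + A * h) ^ n) +
          C * h ^ Suc p * (1 + A * h) ^ Suc n"
      proof (intro add_mono mult_left_mono IH)
        have "1 \<le> (1 + A * h) ^ Suc n" using \<open>0 \<le> A\<close> h by (intro one_le_power) auto
        then show "C * h ^ Suc p \<le> C * h ^ Suc p * (1 + A * h) ^ Suc n"
          using \<open>0 \<le> C\<close> h mult_left_mono[of 1 "(1 + A * h) ^ Suc n" "C * h ^ Suc p"] by simp
      qed (use \<open>0 \<le> A\<close> h in auto)
      also have "\<dots> = real (Suc n) * h * C * h ^ p * (1 + A * h) ^ Suc n"
        by (simp add: algebra_simps)
      finally show ?case unfolding th by simp
    qed
    with grow show ?case unfolding h_def[symmetric] by (blast intro: order_trans)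
  qed
  with \<open>K \<ge> 0\<close> show ?thesis by blast
qed

section \<open>Initial value problems in the positive orthant\<close>

text \<open>
  The essential supremum bounds \<open>\<bar>g\<bar>\<close> almost everywhere. By continuity the bound holds at every
  interior point, because a closed set that contains almost every point of an open set contains all of
  it, and it extends to the end points by passing to the closure.
\<close>

lemma abs_le_Linf_norm:
  assumes "0 < T" and cont: "continuous_on {0..T} g" and t: "t \<in> {0..T}"
  shows "\<bar>g t\<bar> \<le> Linf_norm {0..T} g"
proof -
  let ?M = "lebesgue_on {0..T}" and ?f = "\<lambda>t. ereal \<bar>g t\<bar>"
  define s where "s = esssup ?M ?f"
  have "g \<in> borel_measurable ?M"
    using cont by (intro continuous_imp_measurable_on_sets_lebesgue) auto
  then have meas: "?f \<in> borel_measurable ?M" by measurable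
  have "bounded (g ` {0..T})"
    using cont by (intro compact_imp_bounded compact_continuous_image) auto
  then obtain B where B: "\<forall>t\<in>{0..T}. \<bar>g t\<bar> \<le> B"
    unfolding bounded_iff by auto
  have "s \<le> ereal B"
    unfolding s_def using meas by (rule esssup_I) (use B in \<open>auto intro!: AE_I2\<close>)
  have "AE t in ?M. ?f t \<le> s"
    unfolding s_def by (rule esssup_AE)
  then have ae: "AE t in lebesgue. t \<in> {0..T} \<longrightarrow> ?f t \<le> s"
    by (subst (asm) AE_restrict_space_iff) auto
  have le: "?f t \<le> s" if "t \<in> {0<..<T}" for t
  proof (rule ccontr)
    assume "\<not> ?f t \<le> s"
    then have "s < ?f t" by simp
    then obtain c where c: "s < ereal c" "c < \<bar>g t\<bar>"
      using ereal_dense2[of s "?f t"] by auto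
    let ?C = "{0..T} \<inter> g -` {- c..c}"
    have "AE t \<in> {0<..<T} in lebesgue. t \<in> ?C"
      using ae
    proof eventually_elim
      case (elim x)
      show ?case
      proof
        assume x: "x \<in> {0<..<T}"
        then have "?f x \<le> s" using elim by auto
        then have "?f x < ereal c" using c(1) by (rule le_less_trans)
        with x show "x \<in> ?C" by auto
      qed
    qed
    moreover have "closed ?C"
      using cont by (intro continuous_closed_preimage) auto
    ultimately have "t \<in> ?C"
      using that by (intro mem_closed_if_AE_lebesgue_open[of "{0<..<T}" ?C]) auto
    with c(2) show False by auto
  qed
  \<comment> \<open>The conversion to a real number is harmless only because \<open>s\<close> is finite.\<close>
  have "?f (T / 2) \<le> s" using le[of "T / 2"] \<open>0 < T\<close> by simp
  with \<open>s \<le> ereal B\<close> have fin: "\<bar>s\<bar> \<noteq> \<infinity>" by (cases s) auto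
  have "\<bar>g t\<bar> \<le> real_of_ereal s"
  proof (rule continuous_le_on_closure[of "{0<..<T}" "\<lambda>t. \<bar>g t\<bar>"])
    show "continuous_on (closure {0<..<T}) (\<lambda>t. \<bar>g t\<bar>)"
      using cont \<open>0 < T\<close> by (simp add: continuous_on_rabs)
    show "t \<in> closure {0<..<T}" using t \<open>0 < T\<close> by simp
    show "\<bar>g x\<bar> \<le> real_of_ereal s" if "x \<in> {0<..<T}" for x
      using le[OF that] fin by (cases s) auto
  qed
  then show ?thesis unfolding Linf_norm_def s_def .
qed

lemma compact_pos_orthant_bounded_below:
  fixes S :: "(real ^ 'n) set"
  assumes "compact S" "S \<subseteq> pos_orthant"
  shows "\<exists>a>0. \<forall>x\<in>S. \<forall>i. a \<le> x $ i"
proof (cases "S = {}")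
  case True
  then show ?thesis by (intro exI[of _ 1]) simp
next
  case False
  have "\<exists>a>0. \<forall>x\<in>S. a \<le> x $ i" for i
  proof -
    have "continuous_on S (\<lambda>x. x $ i)" by (intro continuous_intros)
    from continuous_attains_inf[OF assms(1) False this] show ?thesis
      using assms(2) unfolding pos_orthant_def by blast
  qed
  then obtain a where a: "\<And>i. 0 < a i" "\<And>i x. x \<in> S \<Longrightarrow> a i \<le> x $ i" by metis
  show ?thesis
  proof (intro exI[of _ "Min (range a)"] conjI ballI allI)
    show "0 < Min (range a)" using a(1) by simp
    show "Min (range a) \<le> x $ i" if "x \<in> S" for x i
      using a(2)[OF that, of i] by (intro order_trans[OF Min_le]) auto
  qed
qed

text \<open>
  Forward invariance makes the components positive, and by compactness bounded away from \<open>0\<close>, so the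
  minimum \<open>\<alpha>\<close> is positive. The trajectory then lies in the box that is assumed to be inside \<open>\<Omega>\<close>.
\<close>

lemma admissible_ivp_trajectory:
  fixes y :: "real \<Rightarrow> real ^ 'n"
  assumes adm: "admissible_ivp q D \<Omega> T f y\<^sub>0 y" and t: "t \<in> {0..T}"
  shows "y t \<in> interior \<Omega>"
proof -
  have "0 < T" and sol: "solves_ode_on D f T y"
    and pos: "\<And>t. t \<in> {0..T} \<Longrightarrow> y t \<in> pos_orthant"
    and box: "{\<omega>. \<forall>i. 0 < min_component T y \<and> min_component T y \<le> \<omega> $ i \<and>
      \<omega> $ i \<le> max_component T y} \<subseteq> interior \<Omega>"
    using adm unfolding admissible_ivp_def forward_invariant_def by (auto simp: Let_def)
  have cont: "continuous_on {0..T} y"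
    using sol unfolding solves_ode_on_def continuous_on_eq_continuous_within
    by (blast intro: has_vector_derivative_continuous)
  then have "compact (y ` {0..T})" by (intro compact_continuous_image) auto
  with pos obtain a where a: "a > 0" "\<And>t i. t \<in> {0..T} \<Longrightarrow> a \<le> y t $ i"
    using compact_pos_orthant_bounded_below[of "y ` {0..T}"] by blast
  have "a \<le> min_component T y"
    unfolding min_component_def using \<open>0 < T\<close> a
    by (intro cINF_greatest) (auto intro: order_trans[OF _ abs_ge_self])
  moreover have "min_component T y \<le> y t $ i" for i
  proof -
    have "min_component T y \<le> (case (i, t) of (i, t) \<Rightarrow> \<bar>y t $ i\<bar>)"
      unfolding min_component_def using t
      by (intro cINF_lower bdd_belowI[of _ 0]) auto
    then show ?thesis using a(1) a(2)[OF t, of i] by simp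
  qed
  moreover have "y t $ i \<le> max_component T y" for i
  proof -
    have "y t $ i \<le> Linf_norm {0..T} (\<lambda>t. y t $ i)"
    proof -
      have "continuous_on {0..T} (\<lambda>t. y t $ i)" using cont by (intro continuous_intros)
      from abs_le_Linf_norm[OF \<open>0 < T\<close> this t] show ?thesis by simp
    qed
    also have "\<dots> \<le> max_component T y"
      unfolding max_component_def by (intro Max_ge) auto
    finally show ?thesis .
  qed
  ultimately show ?thesis using box a(1) by force
qed

text \<open>
  A whole tube around the compact set \<open>K\<close> lies in the interior of \<open>\<Omega>\<close>. The directional derivatives of
  \<open>f\<close> extend continuously to the compact set \<open>\<Omega>\<close> and are therefore bounded, and the mean value
  inequality applies on each ball of the tube, which is convex even if \<open>\<Omega>\<close> is not.
\<close>

lemma C_1_on_uniform_local_lipschitz: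
  fixes f :: "'a::euclidean_space \<Rightarrow> 'b::real_normed_vector"
  assumes C1: "C_k_on (Suc 0) \<Omega> f" and "compact \<Omega>" and "compact K" "K \<subseteq> interior \<Omega>"
  shows "\<exists>\<epsilon>>0. \<exists>L\<ge>0. \<forall>x\<in>K. \<forall>z. norm (z - x) \<le> \<epsilon> \<longrightarrow>
    z \<in> \<Omega> \<and> norm (f z - f x) \<le> L * norm (z - x)"
proof -
  obtain \<epsilon> where "\<epsilon> > 0" and \<epsilon>: "(\<Union>x\<in>K. cball x \<epsilon>) \<subseteq> interior \<Omega>"
    using compact_subset_open_imp_cball_epsilon_subset[OF \<open>compact K\<close> open_interior \<open>K \<subseteq> interior \<Omega>\<close>] .
  obtain G where G: "\<And>b x. x \<in> interior \<Omega> \<Longrightarrow> G b x = frechet_derivative f (at x) b"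
    "\<And>b. continuous_on \<Omega> (G b)"
    using C1 unfolding C_k_on.simps by metis
  have deriv: "(f has_derivative frechet_derivative f (at x)) (at x)" if "x \<in> interior \<Omega>" for x
    using C1 that by (simp add: frechet_derivative_works)
  have "\<exists>B. \<forall>x\<in>\<Omega>. norm (G b x) \<le> B" for b
  proof -
    have "bounded (G b ` \<Omega>)"
      using G(2) \<open>compact \<Omega>\<close> by (intro compact_imp_bounded compact_continuous_image)
    then show ?thesis unfolding bounded_iff by auto
  qed
  then obtain B where B: "\<And>b x. x \<in> \<Omega> \<Longrightarrow> norm (G b x) \<le> B b" by metis
  define L where "L = (\<Sum>b\<in>Basis. \<bar>B b\<bar>)"
  have "L \<ge> 0" unfolding L_def by (intro sum_nonneg) auto
  have onorm: "onorm (frechet_derivative f (at x)) \<le> L" if x: "x \<in> interior \<Omega>" for x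
  proof (rule onorm_le)
    fix v :: 'a
    interpret Df: bounded_linear "frechet_derivative f (at x)"
      using deriv[OF x] by (rule has_derivative_bounded_linear)
    have "frechet_derivative f (at x) v = frechet_derivative f (at x) (\<Sum>b\<in>Basis. (v \<bullet> b) *\<^sub>R b)"
      by (simp add: euclidean_representation)
    also have "\<dots> = (\<Sum>b\<in>Basis. (v \<bullet> b) *\<^sub>R G b x)"
      using G(1)[OF x] by (simp add: Df.sum Df.scaleR)
    also have "norm \<dots> \<le> (\<Sum>b\<in>Basis. \<bar>B b\<bar> * norm v)"
    proof (rule sum_norm_le)
      fix b :: 'a assume "b \<in> Basis"
      moreover have "norm (G b x) \<le> \<bar>B b\<bar>"
        using B[of x b] x interior_subset by fastforce
      ultimately have "\<bar>v \<bullet> b\<bar> * norm (G b x) \<le> norm v * \<bar>B b\<bar>"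
        by (intro mult_mono Basis_le_norm) auto
      then show "norm ((v \<bullet> b) *\<^sub>R G b x) \<le> \<bar>B b\<bar> * norm v" by (simp add: mult.commute)
    qed
    also have "\<dots> = L * norm v" unfolding L_def by (simp add: sum_distrib_right)
    finally show "norm (frechet_derivative f (at x) v) \<le> L * norm v" .
  qed
  have "z \<in> \<Omega> \<and> norm (f z - f x) \<le> L * norm (z - x)" if x: "x \<in> K" and z: "norm (z - x) \<le> \<epsilon>" for x z
  proof
    have sub: "cball x \<epsilon> \<subseteq> interior \<Omega>" using \<epsilon> x by blast
    have zx: "z \<in> cball x \<epsilon>" "x \<in> cball x \<epsilon>"
      using z \<open>\<epsilon> > 0\<close> by (auto simp: dist_norm norm_minus_commute)
    show "z \<in> \<Omega>" using zx sub interior_subset by blast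
    show "norm (f z - f x) \<le> L * norm (z - x)"
    proof (rule differentiable_bound[OF convex_cball])
      show "(f has_derivative frechet_derivative f (at w)) (at w within cball x \<epsilon>)"
        if "w \<in> cball x \<epsilon>" for w
        by (rule has_derivative_at_withinI[OF deriv[OF subsetD[OF sub that]]])
      show "onorm (frechet_derivative f (at w)) \<le> L" if "w \<in> cball x \<epsilon>" for w
        by (rule onorm[OF subsetD[OF sub that]])
    qed (use zx in auto)
  qed
  with \<open>\<epsilon> > 0\<close> \<open>L \<ge> 0\<close> show ?thesis by blast
qed

section \<open>Logarithmic variables\<close>

definition vec_exp :: "real ^ 'n \<Rightarrow> real ^ 'n" where
  "vec_exp x = (\<chi> i. exp (x $ i))"

definition vec_ln :: "real ^ 'n \<Rightarrow> real ^ 'n" where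
  "vec_ln x = (\<chi> i. ln (x $ i))"

text \<open>
  The relative growth rates \<open>f\<^sub>i / x\<^sub>i\<close>, that is, the right-hand side of the equation for the logarithms
  of the components, still in the original variables.
\<close>

definition growth_rate :: "(real ^ 'n \<Rightarrow> real ^ 'n) \<Rightarrow> real ^ 'n \<Rightarrow> real ^ 'n" where
  "growth_rate f x = (\<chi> i. f x $ i / x $ i)"

lemma vec_exp_ln: "x \<in> pos_orthant \<Longrightarrow> vec_exp (vec_ln x) = x"
  by (simp add: vec_exp_def vec_ln_def pos_orthant_def vec_eq_iff)

text \<open>
  The multiplicative update \<open>y\<^sub>i exp (\<dots>)\<close> is an additive update of \<open>ln y\<^sub>i\<close>: SPIDeC is
  conjugate, through the componentwise exponential, to Picard sweeps for the logarithmic equation.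
\<close>

lemma spidec_stage_vec_exp:
  "spidec_stage M \<tau> f h (vec_exp w) k m =
     vec_exp (picard_sweep M \<tau> (\<lambda>x. growth_rate f (vec_exp x)) h w k m)"
proof (induction k arbitrary: m)
  case 0
  show ?case by (simp add: vec_exp_def growth_rate_def vec_eq_iff exp_add)
next
  case (Suc k)
  show ?case
    unfolding spidec_stage.simps Suc.IH
    by (simp add: vec_exp_def growth_rate_def vec_eq_iff exp_add)
qed

lemma spidec_vec_exp:
  "spidec M \<tau> N\<^sub>k f h (vec_exp w) n =
     vec_exp (((\<lambda>w. picard_sweep M \<tau> (\<lambda>x. growth_rate f (vec_exp x)) h w N\<^sub>k M) ^^ n) w)"
  by (induction n) (simp_all add: spidec_stage_vec_exp)

lemma vec_exp_lipschitz:
  fixes x u :: "real ^ 'n"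
  assumes b: "\<And>i. exp (u $ i) \<le> b" and x: "norm (x - u) \<le> 1"
  shows "norm (vec_exp x - vec_exp u) \<le> real CARD('n) * (b * exp 1) * norm (x - u)"
proof -
  have "\<bar>exp (x $ i) - exp (u $ i)\<bar> \<le> b * exp 1 * norm (x - u)" for i
  proof -
    let ?d = "x $ i - u $ i"
    have d: "\<bar>?d\<bar> \<le> norm (x - u)"
      using component_le_norm_cart[of "x - u" i] by simp
    have "norm (exp (x $ i) - exp (u $ i)) \<le> (b * exp 1) * norm ?d"
    proof (rule differentiable_bound[where S="cball (u $ i) 1" and f'="\<lambda>z h. h * exp z"])
      show "(exp has_derivative (\<lambda>h. h * exp z)) (at z within cball (u $ i) 1)" for z :: real
        by (auto intro!: derivative_eq_intros)
      show "onorm (\<lambda>h. h * exp z) \<le> b * exp 1" if "z \<in> cball (u $ i) 1" for z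
      proof (rule onorm_le)
        fix h :: real
        have "exp z \<le> exp (u $ i + 1)" using that by (auto simp: dist_real_def)
        also have "\<dots> \<le> b * exp 1" using b[of i] by (simp add: exp_add)
        finally show "norm (h * exp z) \<le> b * exp 1 * norm h"
          by (simp add: abs_mult mult.commute mult_left_mono)
      qed
    qed (use d x in \<open>auto simp: dist_real_def\<close>)
    also have "\<dots> \<le> b * exp 1 * norm (x - u)"
      using d order_trans[OF exp_ge_zero b] by (intro mult_left_mono) auto
    finally show ?thesis by simp
  qed
  then have "(\<Sum>i\<in>UNIV. \<bar>(vec_exp x - vec_exp u) $ i\<bar>) \<le> (\<Sum>i\<in>(UNIV :: 'n set). b * exp 1 * norm (x - u))"
    by (intro sum_mono) (simp add: vec_exp_def)
  with norm_le_l1_cart[of "vec_exp x - vec_exp u"] show ?thesis by simp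
qed

lemma growth_rate_lipschitz:
  fixes f :: "real ^ 'n \<Rightarrow> real ^ 'n"
  assumes "0 < a" and a: "\<And>i. a \<le> x $ i" "\<And>i. a \<le> z $ i"
    and F: "norm (f x) \<le> F" and L: "norm (f z - f x) \<le> L * norm (z - x)"
  shows "norm (growth_rate f z - growth_rate f x) \<le>
    real CARD('n) * (L / a + F / a\<^sup>2) * norm (z - x)"
proof -
  have "\<bar>growth_rate f z $ i - growth_rate f x $ i\<bar> \<le> (L / a + F / a\<^sup>2) * norm (z - x)" for i
  proof -
    have x: "0 < x $ i" "a \<le> x $ i" and z: "0 < z $ i" "a \<le> z $ i"
      using a \<open>0 < a\<close> less_le_trans by blast+
    have "growth_rate f z $ i - growth_rate f x $ i =
        (f z - f x) $ i / z $ i - f x $ i * (z - x) $ i / (x $ i * z $ i)"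
      using x z by (simp add: growth_rate_def field_simps)
    also have "\<bar>\<dots>\<bar> \<le> \<bar>(f z - f x) $ i\<bar> / z $ i + \<bar>f x $ i\<bar> * \<bar>(z - x) $ i\<bar> / (x $ i * z $ i)"
      using x z by (intro order_trans[OF abs_triangle_ineq4]) (simp add: abs_mult abs_divide)
    also have "\<dots> \<le> L * norm (z - x) / a + F * norm (z - x) / (a * a)"
    proof (intro add_mono frac_le mult_mono)
      show "\<bar>(f z - f x) $ i\<bar> \<le> L * norm (z - x)"
        using component_le_norm_cart L order_trans by blast
      show "\<bar>f x $ i\<bar> \<le> F" using component_le_norm_cart F order_trans by blast
      show "0 \<le> L * norm (z - x)" using L norm_ge_zero order_trans by blast
      show "0 \<le> F" using F norm_ge_zero order_trans by blast
      then show "0 \<le> F * norm (z - x)" by simp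
      show "\<bar>(z - x) $ i\<bar> \<le> norm (z - x)" by (rule component_le_norm_cart)
    qed (use x z \<open>0 < a\<close> in auto)
    finally show ?thesis by (simp add: algebra_simps power2_eq_square)
  qed
  then have "(\<Sum>i\<in>UNIV. \<bar>(growth_rate f z - growth_rate f x) $ i\<bar>) \<le>
      (\<Sum>i\<in>(UNIV :: 'n set). (L / a + F / a\<^sup>2) * norm (z - x))"
    by (intro sum_mono) simp
  with norm_le_l1_cart[of "growth_rate f z - growth_rate f x"] show ?thesis by simp
qed

section \<open>Convergence of SPIDeC\<close>

text \<open>
  The growth rates along the solution are of class \<open>C\<^sup>M\<^sup>+\<^sup>1\<close>, and they are Lipschitz near
  the trajectory, so the sweeps converge with order \<open>p\<close> in logarithmic variables. The exponential, being Lipschitz near the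
  bounded trajectory, transports the bound back to \<open>y\<close>.
\<close>

lemma spidec_error_bound:
  fixes f :: "real ^ 'n \<Rightarrow> real ^ 'n" and y :: "real \<Rightarrow> real ^ 'n"
  assumes \<tau>0: "0 \<le> \<tau> 0" and mono: "strict_mono_on {..M} \<tau>" and \<tau>M: "\<tau> M = 1"
    and adm: "admissible_ivp q D \<Omega> T f y\<^sub>0 y" and q: "M + 1 \<le> q"
    and p: "p = min (M + 1) (N\<^sub>k + 1)"
  shows "\<exists>K\<ge>0. \<forall>\<^sub>F N in sequentially. \<forall>n\<le>N.
    norm (y (real n * (T / real N)) - spidec M \<tau> N\<^sub>k f (T / real N) y\<^sub>0 n) \<le> K * (T / real N) ^ p"
proof -
  have "0 < T" and y0: "y 0 = y\<^sub>0" and sol: "solves_ode_on D f T y" and "compact \<Omega>"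
    and \<Omega>pos: "\<Omega> \<subseteq> pos_orthant" and Cq: "C_k_on q \<Omega> f"
    using adm unfolding admissible_ivp_def by auto
  have deriv_y: "\<And>t. t \<in> {0..T} \<Longrightarrow> (y has_vector_derivative f (y t)) (at t within {0..T})"
    using sol unfolding solves_ode_on_def by blast
  have in_int: "y t \<in> interior \<Omega>" if "t \<in> {0..T}" for t
    using admissible_ivp_trajectory[OF adm that] .
  have in_\<Omega>: "y t \<in> \<Omega>" if "t \<in> {0..T}" for t
    using in_int[OF that] interior_subset by blast
  have pos: "0 < y t $ i" if "t \<in> {0..T}" for t i
    using in_\<Omega>[OF that] \<Omega>pos unfolding pos_orthant_def by blast
  have CM: "C_k_on (Suc M) \<Omega> f" by (rule C_k_on_mono[OF Cq]) (use q in simp)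

  have smooth_y: "C_k_curve (Suc M) {0..T} y"
    by (rule C_k_curve_SucD[OF C_k_curve_ode_solution[OF deriv_y in_int CM]])
  have smooth_rate: "C_k_curve (Suc M) {0..T} (\<lambda>t. growth_rate f (y t))"
  proof (rule C_k_curve_vec)
    fix i
    have "C_k_curve (Suc M) {0..T} (\<lambda>t. f (y t) $ i)"
      by (rule bounded_linear.C_k_curve[OF bounded_linear_vec_nth
            C_k_curve_compose[OF in_int CM smooth_y]])
    moreover have "C_k_curve (Suc M) {0..T} (\<lambda>t. inverse (y t $ i))"
    proof (rule C_k_curve_inverse)
      show "y t $ i \<noteq> 0" if "t \<in> {0..T}" for t using pos[OF that, of i] by simp
      show "C_k_curve (Suc M) {0..T} (\<lambda>t. y t $ i)"
        by (rule bounded_linear.C_k_curve[OF bounded_linear_vec_nth smooth_y])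
    qed
    ultimately have "C_k_curve (Suc M) {0..T} (\<lambda>t. f (y t) $ i * inverse (y t $ i))"
      by (rule bounded_bilinear.C_k_curve[OF bounded_bilinear_mult])
    then show "C_k_curve (Suc M) {0..T} (\<lambda>t. growth_rate f (y t) $ i)"
      by (simp only: growth_rate_def vec_lambda_beta divide_inverse)
  qed

  define u where "u = (\<lambda>t. vec_ln (y t))"
  define g where "g = (\<lambda>x. growth_rate f (vec_exp x))"
  have exp_u: "vec_exp (u t) = y t" if "t \<in> {0..T}" for t
    unfolding u_def using in_\<Omega>[OF that] \<Omega>pos by (intro vec_exp_ln) blast
  have deriv_u: "(u has_vector_derivative g (u t)) (at t within {0..T})" if t: "t \<in> {0..T}" for t
  proof -
    have "((\<lambda>t. ln (y t $ i)) has_vector_derivative g (u t) $ i) (at t within {0..T})" for i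
    proof -
      have "((\<lambda>t. y t $ i) has_real_derivative f (y t) $ i) (at t within {0..T})"
        using bounded_linear.has_vector_derivative[OF bounded_linear_vec_nth deriv_y[OF t]]
        by (simp add: has_real_derivative_iff_has_vector_derivative)
      from DERIV_chain2[where f=ln and g="\<lambda>t. y t $ i", OF DERIV_ln_divide[OF pos[OF t]] this]
      show ?thesis
        by (simp add: g_def exp_u[OF t] growth_rate_def has_real_derivative_iff_has_vector_derivative)
    qed
    then have "((\<lambda>t. \<Sum>i\<in>UNIV. ln (y t $ i) *\<^sub>R axis i (1::real)) has_vector_derivative
        (\<Sum>i\<in>UNIV. (g (u t) $ i) *\<^sub>R axis i 1)) (at t within {0..T})"
      by (intro has_vector_derivative_sum
          bounded_linear.has_vector_derivative[OF bounded_linear_scaleR_left])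
    moreover have "(\<Sum>i\<in>UNIV. (x $ i) *\<^sub>R axis i (1::real)) = x" for x :: "real ^ 'n"
      using basis_expansion[of x] by (simp add: scalar_mult_eq_scaleR)
    from this[of "vec_ln (y _)"] this[of "g (u t)"]
    have "(\<lambda>t. \<Sum>i\<in>UNIV. ln (y t $ i) *\<^sub>R axis i (1::real)) = u"
      "(\<Sum>i\<in>UNIV. (g (u t) $ i) *\<^sub>R axis i 1) = g (u t)"
      by (simp_all add: u_def vec_ln_def)
    ultimately show ?thesis by simp
  qed
  have smooth_g: "C_k_curve (Suc M) {0..T} (\<lambda>t. g (u t))"
    by (rule C_k_curve_cong[OF _ smooth_rate]) (simp add: g_def exp_u)

  obtain a where "0 < a" and a: "\<And>x i. x \<in> \<Omega> \<Longrightarrow> a \<le> x $ i"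
    using compact_pos_orthant_bounded_below[OF \<open>compact \<Omega>\<close> \<Omega>pos] by blast
  have "bounded \<Omega>" using \<open>compact \<Omega>\<close> by (rule compact_imp_bounded)
  then obtain b where b: "\<And>x. x \<in> \<Omega> \<Longrightarrow> norm x \<le> b" unfolding bounded_iff by blast
  have "continuous_on \<Omega> f" using CM by simp
  then have "bounded (f ` \<Omega>)"
    using \<open>compact \<Omega>\<close> by (intro compact_imp_bounded compact_continuous_image)
  then obtain F where F: "\<And>x. x \<in> \<Omega> \<Longrightarrow> norm (f x) \<le> F" unfolding bounded_iff by blast
  have y_in: "y ` {0..T} \<subseteq> interior \<Omega>" using in_int by blast
  have "continuous_on {0..T} y" using smooth_y by (rule C_k_curve_continuous)
  then have "compact (y ` {0..T})" by (intro compact_continuous_image) auto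
  obtain \<epsilon> L where "0 < \<epsilon>" "0 \<le> L" and lip_f: "\<And>x z. x \<in> y ` {0..T} \<Longrightarrow> norm (z - x) \<le> \<epsilon> \<Longrightarrow>
      z \<in> \<Omega> \<and> norm (f z - f x) \<le> L * norm (z - x)"
    using C_1_on_uniform_local_lipschitz[OF C_k_on_mono[OF CM] \<open>compact \<Omega>\<close> \<open>compact (y ` {0..T})\<close> y_in]
    by (metis Suc_le_mono le0)
  \<comment> \<open>\<open>E\<close> and \<open>G\<close> are Lipschitz constants of the exponential and of the growth rates near the trajectory.\<close>
  define E where "E = real CARD('n) * (b * exp 1)"
  define G where "G = real CARD('n) * (L / a + F / a\<^sup>2)"
  have "0 \<in> {0..T}" using \<open>0 < T\<close> by simp
  have "0 \<le> b" "0 \<le> F"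
    using b[OF in_\<Omega>[OF \<open>0 \<in> {0..T}\<close>]] F[OF in_\<Omega>[OF \<open>0 \<in> {0..T}\<close>]] norm_ge_zero order_trans by blast+
  have "0 \<le> E" "0 \<le> G"
    unfolding E_def G_def using \<open>0 \<le> b\<close> \<open>0 \<le> F\<close> \<open>0 \<le> L\<close> \<open>0 < a\<close> by auto
  have lip_exp: "norm (vec_exp x - y t) \<le> E * norm (x - u t)"
    if t: "t \<in> {0..T}" and x: "norm (x - u t) \<le> 1" for t x
  proof -
    have "exp (u t $ i) \<le> b" for i
    proof -
      have "exp (u t $ i) = y t $ i" using exp_u[OF t] by (metis vec_exp_def vec_lambda_beta)
      also have "\<dots> \<le> norm (y t)" using component_le_norm_cart[of "y t" i] by linarith
      also have "\<dots> \<le> b" using b[OF in_\<Omega>[OF t]] .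
      finally show ?thesis .
    qed
    from vec_exp_lipschitz[OF this x] show ?thesis unfolding E_def exp_u[OF t] .
  qed
  \<comment> \<open>Logarithmic vectors within \<open>r\<close> of the trajectory have exponentials within \<open>\<epsilon>\<close> of it, where \<open>f\<close> is
    controlled.\<close>
  define r where "r = min 1 (\<epsilon> / (E + 1))"
  have "0 < r" unfolding r_def using \<open>0 < \<epsilon>\<close> \<open>0 \<le> E\<close> by simp
  have lip_g: "norm (g x - g (u t)) \<le> G * E * norm (x - u t)"
    if t: "t \<in> {0..T}" and x: "norm (x - u t) \<le> r" for t x
  proof -
    have E: "norm (vec_exp x - y t) \<le> E * norm (x - u t)"
      using lip_exp[OF t] x unfolding r_def by simp
    also have "\<dots> \<le> E * (\<epsilon> / (E + 1))"
      using x \<open>0 \<le> E\<close> unfolding r_def by (intro mult_left_mono) auto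
    also have "\<dots> \<le> \<epsilon>" using \<open>0 \<le> E\<close> \<open>0 < \<epsilon>\<close> by (simp add: field_simps)
    finally have "norm (vec_exp x - y t) \<le> \<epsilon>" .
    then have near: "vec_exp x \<in> \<Omega>" "norm (f (vec_exp x) - f (y t)) \<le> L * norm (vec_exp x - y t)"
      using lip_f[of "y t" "vec_exp x"] t by auto
    have "norm (growth_rate f (vec_exp x) - growth_rate f (y t)) \<le> G * norm (vec_exp x - y t)"
      unfolding G_def
      by (rule growth_rate_lipschitz[OF \<open>0 < a\<close> a[OF in_\<Omega>[OF t]] a[OF near(1)] F[OF in_\<Omega>[OF t]] near(2)])
    also have "\<dots> \<le> G * (E * norm (x - u t))" using E \<open>0 \<le> G\<close> by (rule mult_left_mono)
    finally show ?thesis unfolding g_def exp_u[OF t] by (simp add: mult.assoc)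
  qed

  have inj: "inj_on \<tau> {..M}" using mono by (rule strict_mono_on_imp_inj_on)
  have nodes: "0 \<le> \<tau> j \<and> \<tau> j \<le> 1" if "j \<le> M" for j
    using that strict_mono_on_leD[OF mono, of 0 j] strict_mono_on_leD[OF mono, of j M] \<tau>0 \<tau>M by simp
  define \<Phi> where "\<Phi> = (\<lambda>h w. picard_sweep M \<tau> g h w N\<^sub>k M)"
  have "0 \<le> G * E" using \<open>0 \<le> G\<close> \<open>0 \<le> E\<close> by simp
  have "\<exists>A\<ge>0. \<exists>C\<ge>0. \<exists>\<delta>>0. \<forall>h t w. \<forall>m\<le>M.
      0 < h \<and> h \<le> \<delta> \<and> 0 \<le> t \<and> t + h \<le> T \<and> norm (w - u t) \<le> \<delta> \<longrightarrow>
      norm (picard_sweep M \<tau> g h w N\<^sub>k m - u (t + \<tau> m * h)) \<le>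
        (1 + A * h) * norm (w - u t) + C * h ^ (min N\<^sub>k M + 2)"
    by (rule picard_sweep_error[OF inj nodes deriv_u smooth_g \<open>0 < r\<close> \<open>0 \<le> G * E\<close> lip_g])
  then obtain A C \<delta> where "0 \<le> A" "0 \<le> C" "0 < \<delta>" and step:
    "\<forall>h t w. \<forall>m\<le>M. 0 < h \<and> h \<le> \<delta> \<and> 0 \<le> t \<and> t + h \<le> T \<and> norm (w - u t) \<le> \<delta> \<longrightarrow>
      norm (picard_sweep M \<tau> g h w N\<^sub>k m - u (t + \<tau> m * h)) \<le>
        (1 + A * h) * norm (w - u t) + C * h ^ (min N\<^sub>k M + 2)"
    by (elim exE conjE) (rule that)
  have sucp: "min N\<^sub>k M + 2 = Suc p" unfolding p by simp
  have "0 < p" unfolding p by simp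
  have "norm (\<Phi> h w - u (t + h)) \<le> (1 + A * h) * norm (w - u t) + C * h ^ Suc p"
    if "0 < h" "h \<le> \<delta>" "0 \<le> t" "t + h \<le> T" "norm (w - u t) \<le> \<delta>" for h t w
    using step[rule_format, OF order_refl, of h t w] that unfolding \<Phi>_def sucp \<tau>M by simp
  from one_step_convergence[OF \<open>0 < T\<close> \<open>0 \<le> A\<close> \<open>0 \<le> C\<close> \<open>0 < \<delta>\<close> \<open>0 < p\<close> this]
  obtain K where "0 \<le> K" and K: "\<forall>\<^sub>F N in sequentially. \<forall>n\<le>N.
      norm ((\<Phi> (T / real N) ^^ n) (u 0) - u (real n * (T / real N))) \<le> K * (T / real N) ^ p"
    by blast
  \<comment> \<open>The estimate for the exponential holds at distance at most \<open>1\<close>, which small steps guarantee.\<close>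
  have "(\<lambda>N. K * (T / real N) ^ p) \<longlonglongrightarrow> 0"
    using tendsto_mult[OF tendsto_const[of K] tendsto_power[OF lim_const_over_n[of T], of p]] \<open>0 < p\<close>
    by (simp add: zero_power)
  then have "\<forall>\<^sub>F N in sequentially. K * (T / real N) ^ p < 1"
    by (rule order_tendstoD) simp
  with K eventually_gt_at_top[of 0]
  have "\<forall>\<^sub>F N in sequentially. \<forall>n\<le>N.
    norm (y (real n * (T / real N)) - spidec M \<tau> N\<^sub>k f (T / real N) y\<^sub>0 n) \<le> E * K * (T / real N) ^ p"
  proof eventually_elim
    case (elim N)
    show ?case
    proof (intro allI impI)
      fix n assume "n \<le> N"
      let ?h = "T / real N"
      let ?U = "(\<Phi> ?h ^^ n) (u 0)" and ?t = "real n * ?h"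
      have t: "?t \<in> {0..T}"
        using \<open>n \<le> N\<close> elim(2) \<open>0 < T\<close> by (simp add: field_simps)
      have "spidec M \<tau> N\<^sub>k f ?h y\<^sub>0 n = vec_exp ?U"
        unfolding y0[symmetric] exp_u[OF \<open>0 \<in> {0..T}\<close>, symmetric] spidec_vec_exp \<Phi>_def g_def ..
      moreover have U: "norm (?U - u ?t) \<le> K * ?h ^ p" using elim(1) \<open>n \<le> N\<close> by blast
      then have "norm (vec_exp ?U - y ?t) \<le> E * norm (?U - u ?t)"
        using elim(3) by (intro lip_exp[OF t]) simp
      moreover have "\<dots> \<le> E * (K * ?h ^ p)" using U \<open>0 \<le> E\<close> by (rule mult_left_mono)
      ultimately show "norm (y ?t - spidec M \<tau> N\<^sub>k f ?h y\<^sub>0 n) \<le> E * K * ?h ^ p"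
        by (simp add: norm_minus_commute mult.assoc)
    qed
  qed
  moreover have "0 \<le> E * K" using \<open>0 \<le> E\<close> \<open>0 \<le> K\<close> by simp
  ultimately show ?thesis by blast
qed

theorem theorem4p4:
  fixes M N\<^sub>k q p :: nat and \<tau> :: "nat \<Rightarrow> real" and T :: real
    and D \<Omega> :: "(real ^ 'n) set" and f :: "real ^ 'n \<Rightarrow> real ^ 'n"
    and y\<^sub>0 :: "real ^ 'n" and y :: "real \<Rightarrow> real ^ 'n"
  assumes "0 \<le> \<tau> 0" and "strict_mono_on {..M} \<tau>" and "\<tau> M = 1"
    and "q = max (M + 1) (N\<^sub>k + 1)" and "p = min (M + 1) (N\<^sub>k + 1)"
    and "admissible_ivp q D \<Omega> T f y\<^sub>0 y"
  shows "(\<lambda>N\<^sub>t. global_error (spidec M \<tau> N\<^sub>k) T f y\<^sub>0 y N\<^sub>t)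
           \<in> O[sequentially](\<lambda>N\<^sub>t. (T / real N\<^sub>t) ^ p)
       \<and> convergent_of_order (spidec M \<tau> N\<^sub>k :: (real ^ 'n \<Rightarrow> real ^ 'n) \<Rightarrow> _) q p"
proof -
  \<comment> \<open>The second claim quantifies over all problems, so the bound is proved with problem data of its own.\<close>
  have order_p: "(\<lambda>N\<^sub>t. global_error (spidec M \<tau> N\<^sub>k) T f y\<^sub>0 y N\<^sub>t) \<in> O(\<lambda>N\<^sub>t. (T / real N\<^sub>t) ^ p)"
    if adm: "admissible_ivp q D \<Omega> T f y\<^sub>0 y"
    for D \<Omega> T and f :: "real ^ 'n \<Rightarrow> real ^ 'n" and y\<^sub>0 y
  proof -
    have "M + 1 \<le> q" using assms(4) by simp
    from spidec_error_bound[OF assms(1-3) adm this assms(5)]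
    obtain K where K: "\<forall>\<^sub>F N in sequentially. \<forall>n\<le>N.
        norm (y (real n * (T / real N)) - spidec M \<tau> N\<^sub>k f (T / real N) y\<^sub>0 n) \<le> K * (T / real N) ^ p"
      by blast
    show ?thesis
    proof (rule bigoI)
      show "\<forall>\<^sub>F N in sequentially. norm (global_error (spidec M \<tau> N\<^sub>k) T f y\<^sub>0 y N) \<le>
          K * norm ((T / real N) ^ p)"
        using K
      proof eventually_elim
        case (elim N)
        let ?h = "T / real N"
        let ?S = "(\<lambda>n. norm (y (real n * ?h) - spidec M \<tau> N\<^sub>k f ?h y\<^sub>0 n)) ` {0..N}"
        have err: "global_error (spidec M \<tau> N\<^sub>k) T f y\<^sub>0 y N = Max ?S"
          by (simp add: global_error_def Let_def)
        have "Max ?S \<in> ?S" by (intro Max_in) auto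
        then obtain n where n: "Max ?S = norm (y (real n * ?h) - spidec M \<tau> N\<^sub>k f ?h y\<^sub>0 n)"
          "n \<in> {0..N}"
          by (rule imageE)
        have "0 \<le> Max ?S" "Max ?S \<le> K * ?h ^ p"
          unfolding n(1) using elim n(2) by simp_all
        moreover have "?h ^ p = norm (?h ^ p)"
          using adm unfolding admissible_ivp_def by simp
        ultimately show ?case unfolding err by simp
      qed
    qed
  qed
  from order_p[OF assms(6)] show ?thesis
    unfolding convergent_of_order_def using order_p by blast
qed

end
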